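(* Let $n\in\{2,3\}$. Fix a mesh $\mathcal{M}$ of convex $n$-dimensional polytopes $\{\mathfrak{m}\}$ in $\mathbb{R}^n$ and assign some ordering $\mathbf{v}_1,\ldots,\mathbf{v}_p$ to all the vertices in the mesh. Fix an associated set of generalized barycentric coordinate hat functions $\hat\lambda_1,\ldots,\hat\lambda_p$. Let $$\mathbf{u}\in\operatorname{span}\left\{\hat\lambda_i\nabla\hat\lambda_j \;:\; \text{there exists } \mathfrak{m}\in\mathcal{M} \text{ such that } \mathbf{v}_i,\mathbf{v}_j\in\mathfrak{m}\right\}.$$ Then $\mathbf{u}\in H(\operatorname{curl},\mathcal{M})$.
   Context: Mesh: $\mathcal{M}$ is a cellular complex whose $n$-dimensional cells (elements) $\mathfrak{m}$ are convex polygons if $n=2$ and convex polyhedra if $n=3$, meeting along their lower-dimensional faces. The vertices $\mathbf{v}_i$ of the mesh are the vertices of its elements, and $\mathbf{v}_i\in\mathfrak{m}$ means that $\mathbf{v}_i$ is a vertex of $\mathfrak{m}$; $\mathbf{v}_i$ and $\mathbf{v}_j$ need not be joined by an edge of $\mathfrak{m}$. Generalized barycentric coordinates on a convex polytope $\mathfrak{m}\subset\mathbb{R}^n$ with vertices $\{\mathbf{v}_i\}$: non-negative functions $\lambda_i:\mathfrak{m}\to\mathbb{R}$, one per vertex, such that every linear function $L:\mathfrak{m}\to\mathbb{R}$ (polynomial of degree at most 1) satisfies $L=\sum_i L(\mathbf{v}_i)\lambda_i$. One such set is chosen on each element. Hat functions: for $\mathbf{x}\in\mathfrak{m}$, $\hat\lambda_i(\mathbf{x})=\lambda_i(\mathbf{x})$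 (the coordinate on $\mathfrak{m}$ associated to $\mathbf{v}_i$) if $\mathbf{v}_i\in\mathfrak{m}$, and $\hat\lambda_i(\mathbf{x})=0$ if $\mathbf{v}_i\notin\mathfrak{m}$. At vertices and edges of the mesh any choices of coordinates give the same value; for $n=3$, the same kind of generalized barycentric coordinates (for example Wachspress, or mean value) is chosen on polyhedra sharing a face, so that the coordinates of the two polyhedra agree on the shared face. Thus each $\hat\lambda_i$ is well defined and continuous on the mesh. The vector functions $\hat\lambda_i\nabla\hat\lambda_j$ are defined piecewise, element by element. $H(\operatorname{curl},\mathcal{M})$ is the space of $L^2$ vector fields on the domain covered by $\mathcal{M}$ whose (distributional) curl is in $L^2$; for $n=2$, $\operatorname{curl}(F_1,F_2)^T=\partial F_1/\partial y-\partial F_2/\partial x$, and for $n=3$ it is the usual curl.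
   Formalization: The generalized barycentric coordinates are additionally assumed Lipschitz on each closed element and differentiable almost everywhere in its interior; without some regularity the gradients of the hat functions need not exist or be square integrable. *)

theory Defs
  imports "HOL-Analysis.Analysis" "HOL-Library.Function_Algebras"
begin

section \<open>The real vector space of vector fields\<close>

instantiation "fun" :: (type, real_vector) real_vector
begin

definition scaleR_fun :: "real \<Rightarrow> ('a \<Rightarrow> 'b) \<Rightarrow> 'a \<Rightarrow> 'b" where
  "scaleR_fun c f = (\<lambda>x. c *\<^sub>R f x)"

instance
  by standard (simp_all add: scaleR_fun_def fun_eq_iff scaleR_add_right scaleR_add_left)

end

section \<open>Meshes of convex polytopes\<close>

definition vertices :: "'a::euclidean_space set \<Rightarrow> 'a set" where
  "vertices m = {w. w extreme_point_of m}"

text \<open>A mesh is given by its full-dimensional cells; the lower-dimensional cells are the faces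
  of these.  Two cells may be disjoint, as the empty set is a face of every set.\<close>

definition polytopal_mesh :: "'a::euclidean_space set set \<Rightarrow> bool" where
  "polytopal_mesh M \<longleftrightarrow> finite M
     \<and> (\<forall>m\<in>M. polytope m \<and> aff_dim m = int DIM('a))
     \<and> (\<forall>m\<in>M. \<forall>m'\<in>M. (m \<inter> m') face_of m \<and> (m \<inter> m') face_of m')"

definition mesh_vertices :: "'a::euclidean_space set set \<Rightarrow> 'a set" where
  "mesh_vertices M = (\<Union>m\<in>M. vertices m)"

definition mesh_domain :: "'a::euclidean_space set set \<Rightarrow> 'a set" where
  "mesh_domain M = interior (\<Union>M)"

section \<open>Generalized barycentric coordinates and hat functions\<close>

text \<open>Coordinates are indexed by the vertices themselves: \<open>\<Lambda> w\<close> is the coordinate on \<open>m\<close>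
  associated to the vertex \<open>w\<close>.\<close>

definition barycentric_coords ::
    "'a::euclidean_space set \<Rightarrow> ('a \<Rightarrow> 'a \<Rightarrow> real) \<Rightarrow> bool" where
  "barycentric_coords m \<Lambda> \<longleftrightarrow>
     (\<forall>w\<in>vertices m. \<forall>x\<in>m. 0 \<le> \<Lambda> w x)
     \<and> (\<forall>a c. \<forall>x\<in>m. a \<bullet> x + c = (\<Sum>w\<in>vertices m. (a \<bullet> w + c) * \<Lambda> w x))"

text \<open>The regularity that is implicit in speaking of gradients of the coordinates: they are
  Lipschitz on the closed cell, hence have bounded gradients.  By Rademacher's theorem the second
  conjunct follows from the first; it is listed because it is what gives the gradient its
  (almost everywhere) meaning.\<close>

definition regular_coords ::
    "'a::euclidean_space set \<Rightarrow> ('a \<Rightarrow> 'a \<Rightarrow> real) \<Rightarrow> bool" where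
  "regular_coords m \<Lambda> \<longleftrightarrow>
     (\<forall>w\<in>vertices m. (\<exists>C. C-lipschitz_on m (\<Lambda> w))
        \<and> (AE x in lebesgue. x \<in> interior m \<longrightarrow> (\<Lambda> w) differentiable (at x)))"

text \<open>\<open>\<Lambda> m\<close> is the set of coordinates chosen on the cell \<open>m\<close>.  The last conjunct is the
  requirement that the coordinates of two polyhedra agree on a shared two-dimensional face.
  In the plane it is void, since distinct cells there meet in sets of dimension at most one.\<close>

definition mesh_coords ::
    "'a::euclidean_space set set \<Rightarrow> ('a set \<Rightarrow> 'a \<Rightarrow> 'a \<Rightarrow> real) \<Rightarrow> bool" where
  "mesh_coords M \<Lambda> \<longleftrightarrow>
     (\<forall>m\<in>M. barycentric_coords m (\<Lambda> m) \<and> regular_coords m (\<Lambda> m))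
     \<and> (\<forall>m\<in>M. \<forall>m'\<in>M. m \<noteq> m' \<and> aff_dim (m \<inter> m') = 2 \<longrightarrow>
          (\<forall>w\<in>vertices m \<inter> vertices m'. \<forall>x\<in>m \<inter> m'. \<Lambda> m w x = \<Lambda> m' w x))"

text \<open>On interfaces between cells some cell is selected; for coordinates satisfying
  \<open>mesh_coords\<close> in dimensions two and three the value does not depend on the selection.\<close>

definition hat ::
    "'a::euclidean_space set set \<Rightarrow> ('a set \<Rightarrow> 'a \<Rightarrow> 'a \<Rightarrow> real) \<Rightarrow> 'a \<Rightarrow> 'a \<Rightarrow> real" where
  "hat M \<Lambda> w x =
     (if \<exists>m\<in>M. x \<in> m \<and> w \<in> vertices m
      then \<Lambda> (SOME m. m \<in> M \<and> x \<in> m \<and> w \<in> vertices m) w x else 0)"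

section \<open>Gradients\<close>

definition partial :: "'n \<Rightarrow> (real^'n \<Rightarrow> real) \<Rightarrow> real^'n \<Rightarrow> real" where
  "partial k f x = frechet_derivative f (at x) (axis k 1)"

text \<open>The gradient taken cell by cell; the value 0 on the cell boundaries (a null set) is a
  convention.\<close>

definition cellwise_grad ::
    "(real^'n) set set \<Rightarrow> (real^'n \<Rightarrow> real) \<Rightarrow> real^'n \<Rightarrow> real^'n" where
  "cellwise_grad M f x = (if \<exists>m\<in>M. x \<in> interior m then (\<chi> k. partial k f x) else 0)"

section \<open>The spaces \<open>H(curl)\<close>\<close>

definition L2_space :: "(real^'n) set \<Rightarrow> (real^'n \<Rightarrow> 'b::euclidean_space) set" where
  "L2_space \<Omega> = {f. f \<in> borel_measurable (lebesgue_on \<Omega>)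
                   \<and> integrable (lebesgue_on \<Omega>) (\<lambda>x. (norm (f x))\<^sup>2)}"

primrec iter_partial :: "'n list \<Rightarrow> (real^'n \<Rightarrow> real) \<Rightarrow> real^'n \<Rightarrow> real" where
  "iter_partial [] f = f"
| "iter_partial (k # ks) f = partial k (iter_partial ks f)"

definition test_functions :: "(real^'n) set \<Rightarrow> (real^'n \<Rightarrow> real) set" where
  "test_functions \<Omega> = {\<phi>. (\<forall>ks. iter_partial ks \<phi> differentiable_on UNIV)
      \<and> compact (closure {x. \<phi> x \<noteq> 0}) \<and> closure {x. \<phi> x \<noteq> 0} \<subseteq> \<Omega>}"

text \<open>The pairing of the distribution \<open>\<partial>\<^sub>k f\<close> on \<open>\<Omega>\<close> with the test function \<open>\<phi>\<close>.\<close>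

definition dist_partial ::
    "(real^'n) set \<Rightarrow> 'n \<Rightarrow> (real^'n \<Rightarrow> real) \<Rightarrow> (real^'n \<Rightarrow> real) \<Rightarrow> real" where
  "dist_partial \<Omega> k f \<phi> = - (\<integral>x. f x * partial k \<phi> x \<partial>lebesgue_on \<Omega>)"

definition is_curl2 ::
    "(real^2) set \<Rightarrow> (real^2 \<Rightarrow> real^2) \<Rightarrow> (real^2 \<Rightarrow> real) \<Rightarrow> bool" where
  "is_curl2 \<Omega> F g \<longleftrightarrow> (\<forall>\<phi>\<in>test_functions \<Omega>.
     (\<integral>x. g x * \<phi> x \<partial>lebesgue_on \<Omega>)
       = dist_partial \<Omega> 2 (\<lambda>x. F x $ 1) \<phi> - dist_partial \<Omega> 1 (\<lambda>x. F x $ 2) \<phi>)"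

definition is_curl3 ::
    "(real^3) set \<Rightarrow> (real^3 \<Rightarrow> real^3) \<Rightarrow> (real^3 \<Rightarrow> real^3) \<Rightarrow> bool" where
  "is_curl3 \<Omega> F G \<longleftrightarrow> (\<forall>\<phi>\<in>test_functions \<Omega>.
     (\<integral>x. G x $ 1 * \<phi> x \<partial>lebesgue_on \<Omega>)
       = dist_partial \<Omega> 2 (\<lambda>x. F x $ 3) \<phi> - dist_partial \<Omega> 3 (\<lambda>x. F x $ 2) \<phi>
   \<and> (\<integral>x. G x $ 2 * \<phi> x \<partial>lebesgue_on \<Omega>)
       = dist_partial \<Omega> 3 (\<lambda>x. F x $ 1) \<phi> - dist_partial \<Omega> 1 (\<lambda>x. F x $ 3) \<phi>
   \<and> (\<integral>x. G x $ 3 * \<phi> x \<partial>lebesgue_on \<Omega>)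
       = dist_partial \<Omega> 1 (\<lambda>x. F x $ 2) \<phi> - dist_partial \<Omega> 2 (\<lambda>x. F x $ 1) \<phi>)"

definition Hcurl2 :: "(real^2) set set \<Rightarrow> (real^2 \<Rightarrow> real^2) set" where
  "Hcurl2 M = {F \<in> L2_space (mesh_domain M).
                 \<exists>g \<in> L2_space (mesh_domain M). is_curl2 (mesh_domain M) F g}"

definition Hcurl3 :: "(real^3) set set \<Rightarrow> (real^3 \<Rightarrow> real^3) set" where
  "Hcurl3 M = {F \<in> L2_space (mesh_domain M).
                 \<exists>G \<in> L2_space (mesh_domain M). is_curl3 (mesh_domain M) F G}"

end

theory Submission
  imports Defs
begin

text \<open>On a face of a cell the coordinates of the vertices off that face vanish, and on a segment or a
  point linear precision determines the remaining ones; with the agreement on two-dimensional faces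
  the hat functions are therefore single valued on the mesh, and Lipschitz along every segment in the
  domain.  For two such functions \<open>f\<close> and \<open>g\<close> the weak curl of \<open>f \<nabla>g\<close> is \<open>\<nabla>f \<times> \<nabla>g\<close> (bounded, up to sign in
  the plane).  After the product rule for \<open>f \<phi>\<close>, with \<open>\<phi>\<close> a test function, this is the identity
  \<open>\<integral> \<partial>\<^sub>a g \<partial>\<^sub>b h = \<integral> \<partial>\<^sub>b g \<partial>\<^sub>a h\<close> for compactly supported \<open>h = f \<phi>\<close>.  Its analogue for difference quotients
  is exact, by translation invariance of Lebesgue measure, and dominated convergence gives the limit.\<close>

section \<open>Hat functions are single valued\<close>

text \<open>The argument therefore treats the whole domain at once and never mentions a face once
  the hat functions are known to be single valued. A second obstacle is that \<open>h\<close> = f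
  \<phi> is itself only Lipschitz, so the identity cannot be obtained by moving both derivatives of
  the product onto one factor. At the level of difference quotients this problem disappears:
  differences in two directions commute, and the adjoint of a forward difference is a backward one.
  The bound 3 on the dimension enters because distinct cells meet in dimension at most two. A face
  with four or more vertices does not determine its coordinates, which is why agreement on such
  faces is part of \<open>mesh_coords\<close> while agreement on points and segments is
  proved.\<close>

lemma finite_vertices: "polytope m \<Longrightarrow> finite (vertices m)"
  unfolding vertices_def by (simp add: finite_polyhedron_extreme_points polytope_imp_polyhedron)

section \<open>Barycentric coordinates on faces and their uniqueness\<close>

lemma vertices_face: "F face_of m \<Longrightarrow> vertices F = vertices m \<inter> F"
  unfolding vertices_def by (auto simp: extreme_point_of_face)

lemma vertices_subset: "vertices m \<subseteq> m"
  unfolding vertices_def by (auto simp: extreme_point_of_def)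

text \<open>Faces of a polytope are exposed, so some function \<open>b - a \<bullet> x\<close> is
  nonnegative on \<open>m\<close> with zero set exactly \<open>F\<close> in \<open>m\<close>. Its
  expansion at a point of \<open>F\<close> is a sum of nonnegative terms with total 0, and the
  factor belonging to a vertex off \<open>F\<close> is strictly positive.\<close>

lemma barycentric_coords_vanish_on_face:
  assumes "polytope m" "barycentric_coords m \<Lambda>" "F face_of m" "x \<in> F"
    and w: "w \<in> vertices m" "w \<notin> F"
  shows "\<Lambda> w x = 0"
proof -
  obtain a b where ab: "m \<subseteq> {x. a \<bullet> x \<le> b}" "F = m \<inter> {x. a \<bullet> x = b}"
    using assms by (metis exposed_face_of_def exposed_face_of_polyhedron polytope_imp_polyhedron)
  have xm: "x \<in> m" "a \<bullet> x = b" using ab assms by auto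
  have "(- a) \<bullet> x + b = (\<Sum>w\<in>vertices m. ((- a) \<bullet> w + b) * \<Lambda> w x)"
    using assms(2) xm(1) unfolding barycentric_coords_def by blast
  then have "(\<Sum>w\<in>vertices m. (b - a \<bullet> w) * \<Lambda> w x) = 0"
    using xm by simp
  moreover have "0 \<le> (b - a \<bullet> w) * \<Lambda> w x" if "w \<in> vertices m" for w
  proof -
    have "w \<in> m" using that vertices_subset by blast
    then have "a \<bullet> w \<le> b" using ab by auto
    moreover have "0 \<le> \<Lambda> w x"
      using that assms(2) xm unfolding barycentric_coords_def by blast
    ultimately show ?thesis by simp
  qed
  ultimately have "\<forall>w\<in>vertices m. (b - a \<bullet> w) * \<Lambda> w x = 0"
    using sum_nonneg_eq_0_iff[OF finite_vertices[OF assms(1)], of "\<lambda>w. (b - a \<bullet> w) * \<Lambda> w x"]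
    by blast
  then have "(b - a \<bullet> w) * \<Lambda> w x = 0"
    using w by blast
  moreover have "b - a \<bullet> w \<noteq> 0"
    using w ab vertices_subset by auto
  ultimately show ?thesis by simp
qed

text \<open>By the vanishing above, the expansion loses only zero terms. Two cells sharing a face
  thus give two systems of coordinates on that same face, to be compared there.\<close>

lemma barycentric_coords_face:
  assumes "polytope m" "barycentric_coords m \<Lambda>" "F face_of m"
  shows "barycentric_coords F \<Lambda>"
proof -
  have V: "vertices F = vertices m \<inter> F" and Fm: "F \<subseteq> m"
    by (simp_all add: vertices_face[OF assms(3)] face_of_imp_subset[OF assms(3)])
  have "(\<Sum>w\<in>vertices m. (a \<bullet> w + c) * \<Lambda> w x) = (\<Sum>w\<in>vertices F. (a \<bullet> w + c) * \<Lambda> w x)"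
    if "x \<in> F" for a c x
    unfolding V
    by (rule sum.mono_neutral_right)
       (auto simp: finite_vertices assms barycentric_coords_vanish_on_face[OF assms that])
  then show ?thesis
    using assms(2) Fm unfolding barycentric_coords_def V by auto
qed

text \<open>The difference of two systems annihilates every affine function, so a nonzero difference
  would be the coefficient vector of an affine dependence among the vertices.\<close>

lemma barycentric_coords_unique:
  fixes F :: "'a::euclidean_space set"
  assumes "finite (vertices F)" "\<not> affine_dependent (vertices F)"
    and "barycentric_coords F \<Lambda>" "barycentric_coords F \<Lambda>'" "x \<in> F" "w \<in> vertices F"
  shows "\<Lambda> w x = \<Lambda>' w x"
proof -
  define D where "D w = \<Lambda> w x - \<Lambda>' w x" for w
  have lin: "(\<Sum>w\<in>vertices F. (a \<bullet> w + c) * D w) = 0" for a c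
  proof -
    have "a \<bullet> x + c = (\<Sum>w\<in>vertices F. (a \<bullet> w + c) * \<Lambda> w x)"
         "a \<bullet> x + c = (\<Sum>w\<in>vertices F. (a \<bullet> w + c) * \<Lambda>' w x)"
      using assms unfolding barycentric_coords_def by blast+
    then show ?thesis
      by (simp add: D_def right_diff_distrib sum_subtractf)
  qed
  have "sum D (vertices F) = 0"
    using lin[of 0 1] by simp
  moreover have "(\<Sum>w\<in>vertices F. D w *\<^sub>R w) = 0"
  proof -
    \<comment> \<open>Linear precision is a family of scalar identities. Testing it with the vector
      \<open>s\<close> itself gives \<open>s \<bullet> s = 0\<close>.\<close>
    define s where "s = (\<Sum>w\<in>vertices F. D w *\<^sub>R w)"
    have "s \<bullet> s = (\<Sum>w\<in>vertices F. (s \<bullet> w + 0) * D w)"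
      by (subst (2) s_def) (simp add: inner_sum_right mult.commute)
    then show ?thesis using lin[of s 0] s_def by simp
  qed
  ultimately have "D w = 0"
    using assms affine_dependent_explicit_finite[OF assms(1)] by blast
  then show ?thesis by (simp add: D_def)
qed

text \<open>Such a polytope is empty, a point or a segment. In dimension two this already fails, for
  instance for a square.\<close>

lemma affine_independent_vertices:
  fixes F :: "'a::euclidean_space set"
  assumes "polytope F" "aff_dim F \<le> 1"
  shows "\<not> affine_dependent (vertices F)"
proof (cases "F = {}")
  case True
  then show ?thesis by (simp add: vertices_def extreme_point_of_def)
next
  case False
  then obtain a b where "F = closed_segment a b"
    using compact_convex_collinear_segment assms
    by (metis collinear_aff_dim polytope_imp_compact polytope_imp_convex)
  then have "vertices F = {a, b}"
    by (auto simp: vertices_def extreme_point_of_segment)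
  then show ?thesis
    by (simp add: affine_independent_2)
qed

section \<open>Conformity of the mesh and agreement across cells\<close>

lemma mesh_cellD:
  assumes "polytopal_mesh M" "m \<in> M"
  shows "polytope m" "convex m" "compact m" "finite (vertices m)"
  using assms finite_vertices polytope_imp_convex polytope_imp_compact
  unfolding polytopal_mesh_def by auto

text \<open>There are no hanging nodes: the intersection is a face of both cells, and the extreme
  points of a face are the extreme points of the cell that lie in it.\<close>

lemma mesh_vertices_shared:
  assumes "polytopal_mesh M" "m \<in> M" "m' \<in> M" "w \<in> vertices m" "w \<in> m'"
  shows "w \<in> vertices m'"
proof -
  have "(m \<inter> m') face_of m" "(m \<inter> m') face_of m'"
    using assms unfolding polytopal_mesh_def by auto
  then show ?thesis
    using assms vertices_face vertices_subset by blast
qed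

text \<open>The intersection of distinct cells is a proper face of at least one of them, and both
  are full-dimensional, so its dimension is at most 2. Dimension 2 is covered by
  \<open>mesh_coords\<close>; below that, both systems restrict to coordinates on the common face,
  where they are unique.\<close>

lemma mesh_coords_agree:
  fixes M :: "'a::euclidean_space set set"
  assumes dim: "DIM('a) \<le> 3" and M: "polytopal_mesh M" and \<Lambda>: "mesh_coords M \<Lambda>"
    and m: "m \<in> M" "m' \<in> M" and x: "x \<in> m" "x \<in> m'"
    and w: "w \<in> vertices m" "w \<in> vertices m'"
  shows "\<Lambda> m w x = \<Lambda> m' w x"
proof (cases "m = m'")
  case False
  let ?F = "m \<inter> m'"
  have F: "?F face_of m" "?F face_of m'"
    using m M unfolding polytopal_mesh_def by auto
  have d: "aff_dim m = int DIM('a)" "aff_dim m' = int DIM('a)"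
    using m M unfolding polytopal_mesh_def by auto
  have "?F \<noteq> m \<or> ?F \<noteq> m'" using False by auto
  then have "aff_dim ?F < int DIM('a)"
    using F d face_of_aff_dim_lt mesh_cellD(2)[OF M] m by metis
  with dim have *: "aff_dim ?F = 2 \<or> aff_dim ?F \<le> 1" by linarith
  have b: "barycentric_coords m (\<Lambda> m)" "barycentric_coords m' (\<Lambda> m')"
    using \<Lambda> m unfolding mesh_coords_def by auto
  show ?thesis
  proof (cases "aff_dim ?F = 2")
    case True
    then show ?thesis using \<Lambda> m False w x unfolding mesh_coords_def by blast
  next
    case nF: False
    have pF: "polytope ?F" using F(1) face_of_polytope_polytope mesh_cellD(1)[OF M] m by blast
    show ?thesis
    proof (rule barycentric_coords_unique[where F = ?F and \<Lambda> = "\<Lambda> m" and \<Lambda>' = "\<Lambda> m'"])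
      show "finite (vertices ?F)" using pF finite_vertices by blast
      show "\<not> affine_dependent (vertices ?F)"
        using affine_independent_vertices pF nF * by blast
      show "barycentric_coords ?F (\<Lambda> m)" "barycentric_coords ?F (\<Lambda> m')"
        using barycentric_coords_face[OF mesh_cellD(1)[OF M m(1)] b(1) F(1)]
          barycentric_coords_face[OF mesh_cellD(1)[OF M m(2)] b(2) F(2)] .
      show "x \<in> ?F" using x by simp
      show "w \<in> vertices ?F"
        using w vertices_face[OF F(1)] vertices_subset by blast
    qed
  qed
qed simp

text \<open>This removes the choice in \<open>hat\<close>. The case that needs an argument is a
  selected cell having \<open>w\<close> as a vertex while \<open>m\<close> does not: then
  \<open>w\<close> lies off the common face, \<open>x\<close> lies on it, and the selected
  coordinate vanishes at \<open>x\<close>.\<close>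

lemma hat_eq:
  fixes M :: "'a::euclidean_space set set"
  assumes dim: "DIM('a) \<le> 3" and M: "polytopal_mesh M" and \<Lambda>: "mesh_coords M \<Lambda>"
    and m: "m \<in> M" and x: "x \<in> m"
  shows "hat M \<Lambda> w x = (if w \<in> vertices m then \<Lambda> m w x else 0)"
proof (cases "\<exists>m\<in>M. x \<in> m \<and> w \<in> vertices m")
  case False
  then show ?thesis using m x by (auto simp: hat_def)
next
  case True
  define m' where "m' = (SOME m. m \<in> M \<and> x \<in> m \<and> w \<in> vertices m)"
  have "m' \<in> M \<and> x \<in> m' \<and> w \<in> vertices m'"
    unfolding m'_def by (rule someI_ex) (use True in blast)
  then have m': "m' \<in> M" "x \<in> m'" "w \<in> vertices m'" by auto
  have h: "hat M \<Lambda> w x = \<Lambda> m' w x"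
    unfolding hat_def m'_def by (rule if_P[OF True])
  show ?thesis
  proof (cases "w \<in> vertices m")
    case True
    then show ?thesis
      using h mesh_coords_agree[OF dim M \<Lambda> m'(1) m m'(2) x m'(3) True] by simp
  next
    case False
    have w: "w \<notin> m' \<inter> m" using mesh_vertices_shared[OF M m'(1) m m'(3)] False by blast
    have F: "(m' \<inter> m) face_of m'" using M m m' unfolding polytopal_mesh_def by simp
    have b: "barycentric_coords m' (\<Lambda> m')" using \<Lambda> m' unfolding mesh_coords_def by simp
    have "\<Lambda> m' w x = 0"
      using barycentric_coords_vanish_on_face[OF mesh_cellD(1)[OF M m'(1)] b F _ m'(3) w] m' x
      by simp
    then show ?thesis using h False by simp
  qed
qed

lemma hat_outside: "x \<notin> \<Union>M \<Longrightarrow> hat M \<Lambda> w x = 0"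
  by (auto simp: hat_def)

lemma hat_lipschitz_on_cells:
  fixes M :: "'a::euclidean_space set set"
  assumes dim: "DIM('a) \<le> 3" and M: "polytopal_mesh M" and \<Lambda>: "mesh_coords M \<Lambda>"
  obtains C where "\<And>m. m \<in> M \<Longrightarrow> C-lipschitz_on m (hat M \<Lambda> w)" "0 \<le> C"
proof -
  have "\<exists>C. C-lipschitz_on m (hat M \<Lambda> w)" if m: "m \<in> M" for m
  proof (cases "w \<in> vertices m")
    case True
    then obtain C where "C-lipschitz_on m (\<Lambda> m w)"
      using \<Lambda> m unfolding mesh_coords_def regular_coords_def by blast
    then have "C-lipschitz_on m (hat M \<Lambda> w)"
      by (rule lipschitz_on_transform) (simp add: hat_eq[OF dim M \<Lambda> m] True)
    then show ?thesis by blast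
  next
    case False
    have "0-lipschitz_on m (hat M \<Lambda> w)"
      by (rule lipschitz_on_transform[OF lipschitz_on_constant[of m 0]])
         (simp add: hat_eq[OF dim M \<Lambda> m] False)
    then show ?thesis by blast
  qed
  then obtain c where c: "\<And>m. m \<in> M \<Longrightarrow> (c m)-lipschitz_on m (hat M \<Lambda> w)"
    by metis
  have fin: "finite M" using M unfolding polytopal_mesh_def by simp
  have c0: "0 \<le> c m" if "m \<in> M" for m using c[OF that] lipschitz_on_nonneg by blast
  \<comment> \<open>The sum of the nonnegative cell constants dominates each of them, and is also
    defined for an empty mesh.\<close>
  show thesis
  proof (rule that[of "sum c M"])
    show "(sum c M)-lipschitz_on m (hat M \<Lambda> w)" if "m \<in> M" for m
      using c[OF that] by (rule lipschitz_on_le) (rule member_le_sum; use fin c0 that in simp)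
    show "0 \<le> sum c M" using c0 by (simp add: sum_nonneg)
  qed
qed

section \<open>Exchange of partial derivatives under the integral\<close>

definition diff_quot :: "'n \<Rightarrow> real \<Rightarrow> (real^'n \<Rightarrow> real) \<Rightarrow> real^'n \<Rightarrow> real" where
  "diff_quot k s f x = (f (x + s *\<^sub>R axis k 1) - f x) / s"

text \<open>Stated along sequences, the form in which dominated convergence is applied. The steps
  may be negative, which matters for the backward quotients.\<close>

lemma diff_quot_tendsto_partial:
  assumes f: "f differentiable (at x)" and s: "s \<longlonglongrightarrow> 0" "\<And>n. s n \<noteq> 0"
  shows "(\<lambda>n. diff_quot k (s n) f x) \<longlonglongrightarrow> partial k f x"
proof -
  let ?D = "frechet_derivative f (at x)" and ?e = "axis k 1"
  have D: "(f has_derivative ?D) (at x)"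
    using f frechet_derivative_works by blast
  have "((\<lambda>t. f (x + t *\<^sub>R ?e)) has_derivative (\<lambda>t. ?D (t *\<^sub>R ?e))) (at 0)"
    by (rule has_derivative_compose[of "\<lambda>t. x + t *\<^sub>R ?e" "\<lambda>t. t *\<^sub>R ?e" 0 UNIV f ?D])
       (auto intro!: derivative_eq_intros D)
  moreover have "?D (t *\<^sub>R ?e) = partial k f x * t" for t
    using linear_scale[OF has_derivative_linear[OF D]] by (simp add: partial_def)
  ultimately have "((\<lambda>t. f (x + t *\<^sub>R ?e)) has_field_derivative partial k f x) (at 0)"
    by (simp add: has_field_derivative_def)
  then have "((\<lambda>t. (f (x + t *\<^sub>R ?e) - f x) / t) \<longlongrightarrow> partial k f x) (at 0)"
    by (simp add: has_field_derivative_iff)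
  then have "((\<lambda>t. (f (x + t *\<^sub>R ?e) - f x) / t) \<circ> s) \<longlonglongrightarrow> partial k f x"
    using s unfolding tendsto_at_iff_sequentially by blast
  then show ?thesis by (simp add: diff_quot_def o_def)
qed

lemma integral_lborel_translation:
  fixes f :: "'a::euclidean_space \<Rightarrow> real"
  assumes [measurable]: "f \<in> borel_measurable borel"
  shows "(\<integral>x. f (x + c) \<partial>lborel) = (\<integral>x. f x \<partial>lborel)"
    and "integrable lborel f \<Longrightarrow> integrable lborel (\<lambda>x. f (x + c))"
proof -
  have "(\<integral>x. f x \<partial>lborel) = (\<integral>x. f x \<partial>distr lborel borel ((+) c))"
    by (simp add: lborel_distr_plus)
  also have "\<dots> = (\<integral>x. f (c + x) \<partial>lborel)"
    by (rule integral_distr) auto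
  finally show "(\<integral>x. f (x + c) \<partial>lborel) = (\<integral>x. f x \<partial>lborel)"
    by (simp add: add.commute)
  assume "integrable lborel f"
  then have "integrable (distr lborel borel ((+) c)) f"
    by (simp add: lborel_distr_plus)
  then have "integrable lborel (\<lambda>x. f (c + x))"
    by (subst (asm) integrable_distr_eq) auto
  then show "integrable lborel (\<lambda>x. f (x + c))"
    by (simp add: add.commute)
qed

text \<open>Both products expand into four integrals of the form g(x + c) h(x + d). Translation
  invariance makes such an integral depend on d - c alone, and the four values of d - c are the same
  on both sides. Passing to the adjoint turns forward into backward steps, hence \<open>- s\<close>
  and the exchanged axes on the right. The integrals are over \<open>lborel\<close>, since
  translates of Borel functions are Borel.\<close>

lemma integral_diff_quot_exchange:
  fixes g h :: "real^'n \<Rightarrow> real"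
  assumes [measurable]: "g \<in> borel_measurable borel" "h \<in> borel_measurable borel"
    and g: "\<And>x. \<bar>g x\<bar> \<le> B" and h: "integrable lborel h"
  shows "(\<integral>x. diff_quot a s g x * diff_quot b s h x \<partial>lborel)
       = (\<integral>x. diff_quot b (- s) g x * diff_quot a (- s) h x \<partial>lborel)"
proof -
  let ?a = "s *\<^sub>R axis a 1 :: real^'n" and ?b = "s *\<^sub>R axis b 1 :: real^'n"
  \<comment> \<open>Boundedness of \<open>g\<close> and integrability of \<open>h\<close> make every
    shifted product integrable, which is what permits the expansion by linearity.\<close>
  have int: "integrable lborel (\<lambda>x. g (x + c) * h (x + d))" for c d
  proof (rule Bochner_Integration.integrable_bound)
    show "integrable lborel (\<lambda>x. B * \<bar>h (x + d)\<bar>)"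
      using integral_lborel_translation(2)[OF _ h] by auto
    have "\<bar>g (x + c)\<bar> * \<bar>h (x + d)\<bar> \<le> B * \<bar>h (x + d)\<bar>" for x
      by (rule mult_right_mono) (auto simp: g)
    then have "norm (g (x + c) * h (x + d)) \<le> norm (B * \<bar>h (x + d)\<bar>)" for x
      by (metis abs_ge_self abs_mult order_trans real_norm_def)
    then show "AE x in lborel. norm (g (x + c) * h (x + d)) \<le> norm (B * \<bar>h (x + d)\<bar>)"
      by simp
  qed measurable
  have eqn: "(\<integral>x. (g (x + c) - g x) * (h (x + d) - h x) \<partial>lborel) =
     (\<integral>x. g (x + c) * h (x + d) \<partial>lborel) - (\<integral>x. g (x + c) * h x \<partial>lborel)
     - (\<integral>x. g x * h (x + d) \<partial>lborel) + (\<integral>x. g x * h x \<partial>lborel)" for c d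
    using int[of c d] int[of c 0] int[of 0 d] int[of 0 0]
    by (simp add: left_diff_distrib right_diff_distrib)
  have sh: "(\<integral>x. g (x + c) * h (x + d) \<partial>lborel) = (\<integral>x. g (x + (c + e)) * h (x + (d + e)) \<partial>lborel)" for c d e
  proof -
    have "(\<lambda>x. g (x + c) * h (x + d)) \<in> borel_measurable borel" by measurable
    from integral_lborel_translation(1)[OF this, of e] show ?thesis
      by (simp add: add_ac)
  qed
  have "(\<integral>x. (g (x + ?a) - g x) * (h (x + ?b) - h x) \<partial>lborel)
      = (\<integral>x. (g (x + - ?b) - g x) * (h (x + - ?a) - h x) \<partial>lborel)"
    unfolding eqn
    using sh[of "- ?b" "- ?a" "?a + ?b"] sh[of "- ?b" 0 ?b] sh[of 0 "- ?a" ?a]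
    by (simp add: add_ac)
  then have "(\<integral>x. (g (x + ?a) - g x) * (h (x + ?b) - h x) / (s * s) \<partial>lborel)
      = (\<integral>x. (g (x + - ?b) - g x) * (h (x + - ?a) - h x) / (s * s) \<partial>lborel)"
    by simp
  then show ?thesis
    by (simp add: diff_quot_def)
qed

text \<open>The Lipschitz bound is required along segments only: a mesh domain need not be quasiconvex, so
  a function that is Lipschitz on every cell need not be Lipschitz on the domain.\<close>

definition weakly_regular :: "(real^'n) set \<Rightarrow> (real^'n \<Rightarrow> real) \<Rightarrow> bool" where
  "weakly_regular \<Omega> f \<longleftrightarrow> f \<in> borel_measurable borel \<and> (\<exists>B. \<forall>x. \<bar>f x\<bar> \<le> B)
     \<and> (\<exists>C. \<forall>x y. closed_segment x y \<subseteq> \<Omega> \<longrightarrow> \<bar>f x - f y\<bar> \<le> C * dist x y)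
     \<and> (AE x in lebesgue. x \<in> \<Omega> \<longrightarrow> f differentiable (at x))"

lemma diff_quot_bound:
  assumes lip: "\<And>x y. closed_segment x y \<subseteq> \<Omega> \<Longrightarrow> \<bar>f x - f y\<bar> \<le> C * dist x y"
    and "cball x \<bar>s\<bar> \<subseteq> \<Omega>" "s \<noteq> 0"
  shows "\<bar>diff_quot k s f x\<bar> \<le> C"
proof -
  let ?y = "x + s *\<^sub>R axis k 1"
  have d: "dist ?y x = \<bar>s\<bar>" by (simp add: dist_norm)
  have "closed_segment ?y x \<subseteq> cball x \<bar>s\<bar>"
    by (rule closed_segment_subset) (auto simp: d dist_commute[of x])
  then have "\<bar>f ?y - f x\<bar> \<le> C * \<bar>s\<bar>"
    using lip[of ?y x] assms(2) d by auto
  then show ?thesis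
    using assms(3) by (simp add: diff_quot_def abs_divide divide_le_eq)
qed

section \<open>Bounds and measurability of derivatives that exist almost everywhere\<close>

lemma null_sequence_below:
  fixes e :: real
  assumes "0 < e"
  obtains s where "s \<longlonglongrightarrow> 0" "\<And>n::nat. s n \<noteq> 0" "\<And>n. \<bar>s n\<bar> \<le> e"
proof
  show "(\<lambda>n. e * inverse (real (Suc n))) \<longlonglongrightarrow> 0"
    using tendsto_mult[OF tendsto_const LIMSEQ_inverse_real_of_nat, of e] by simp
  show "e * inverse (real (Suc n)) \<noteq> 0" for n using assms by simp
  show "\<bar>e * inverse (real (Suc n))\<bar> \<le> e" for n
  proof -
    have "inverse (real (Suc n)) \<le> 1" by (simp add: field_simps)
    then show ?thesis using assms by (simp add: abs_mult mult_left_le)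
  qed
qed

lemma weakly_regular_lipschitz:
  assumes "weakly_regular \<Omega> f"
  obtains C where "0 \<le> C" "\<And>x y. closed_segment x y \<subseteq> \<Omega> \<Longrightarrow> \<bar>f x - f y\<bar> \<le> C * dist x y"
proof -
  obtain C where C: "\<And>x y. closed_segment x y \<subseteq> \<Omega> \<Longrightarrow> \<bar>f x - f y\<bar> \<le> C * dist x y"
    using assms unfolding weakly_regular_def by blast
  show thesis
  proof (rule that[of "\<bar>C\<bar>"])
    show "\<bar>f x - f y\<bar> \<le> \<bar>C\<bar> * dist x y" if "closed_segment x y \<subseteq> \<Omega>" for x y
      by (rule order_trans[OF C[OF that]]) (simp add: mult_right_mono)
  qed simp
qed

text \<open>Sufficiently short segments from a point of an open set stay inside, so the Lipschitz
  bound along segments controls all small difference quotients and hence their limit.\<close>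

lemma partial_bound:
  assumes lip: "\<And>x y. closed_segment x y \<subseteq> \<Omega> \<Longrightarrow> \<bar>f x - f y\<bar> \<le> C * dist x y"
    and "open \<Omega>" "x \<in> \<Omega>" and f: "f differentiable (at x)"
  shows "\<bar>partial k f x\<bar> \<le> C"
proof -
  obtain e where e: "0 < e" "cball x e \<subseteq> \<Omega>"
    using assms(2,3) open_contains_cball by blast
  obtain s where s: "s \<longlonglongrightarrow> 0" "\<And>n::nat. s n \<noteq> 0" "\<And>n. \<bar>s n\<bar> \<le> e"
    using null_sequence_below[OF e(1)] by blast
  have lim: "(\<lambda>n. \<bar>diff_quot k (s n) f x\<bar>) \<longlonglongrightarrow> \<bar>partial k f x\<bar>"
    by (intro tendsto_rabs diff_quot_tendsto_partial f s)
  have "\<bar>diff_quot k (s n) f x\<bar> \<le> C" for n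
  proof (rule diff_quot_bound[OF lip])
    show "cball x \<bar>s n\<bar> \<subseteq> \<Omega>" using s(3) subset_cball e(2) by (meson order_trans)
  qed (use s in auto)
  then show ?thesis
    using lim by (intro Lim_bounded[OF lim, of 0]) simp
qed

lemma weakly_regular_partial_bound:
  assumes "weakly_regular \<Omega> f" "open \<Omega>"
  obtains C where "AE x in lebesgue. x \<in> \<Omega> \<longrightarrow> \<bar>partial k f x\<bar> \<le> C"
proof -
  obtain C where C: "\<And>x y. closed_segment x y \<subseteq> \<Omega> \<Longrightarrow> \<bar>f x - f y\<bar> \<le> C * dist x y"
    using assms unfolding weakly_regular_def by blast
  have "AE x in lebesgue. x \<in> \<Omega> \<longrightarrow> f differentiable (at x)"
    using assms unfolding weakly_regular_def by blast
  then have "AE x in lebesgue. x \<in> \<Omega> \<longrightarrow> \<bar>partial k f x\<bar> \<le> C"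
    by eventually_elim (use partial_bound[OF C assms(2)] in blast)
  then show thesis by (rule that)
qed

text \<open>Where \<open>f\<close> is not differentiable, \<open>frechet_derivative\<close> is an
  arbitrary choice, so measurability cannot be read off \<open>partial\<close>. It comes from the
  limit of Borel difference quotients, which agrees almost everywhere, and completeness of Lebesgue
  measure.\<close>

lemma weakly_regular_partial_measurable:
  assumes "weakly_regular \<Omega> f" "open \<Omega>"
  shows "(\<lambda>x. if x \<in> \<Omega> then partial k f x else 0) \<in> borel_measurable lebesgue"
proof -
  obtain s where s: "s \<longlonglongrightarrow> 0" "\<And>n::nat. s n \<noteq> 0" "\<And>n. \<bar>s n\<bar> \<le> (1::real)"
    using null_sequence_below[of 1] by auto
  have [measurable]: "f \<in> borel_measurable borel" "\<Omega> \<in> sets borel"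
    using assms unfolding weakly_regular_def by auto
  \<comment> \<open>\<open>lim\<close> is total, and it is Borel measurable even though the sequence
    may diverge at some points.\<close>
  let ?L = "\<lambda>x. if x \<in> \<Omega> then lim (\<lambda>n. diff_quot k (s n) f x) else 0"
  show ?thesis
  proof (rule borel_measurable_AE)
    have "?L \<in> borel_measurable lborel"
      unfolding diff_quot_def by measurable
    then show "?L \<in> borel_measurable lebesgue"
      by (rule measurable_completion)
    have "AE x in lebesgue. x \<in> \<Omega> \<longrightarrow> f differentiable (at x)"
      using assms unfolding weakly_regular_def by blast
    then show "AE x in lebesgue. ?L x = (if x \<in> \<Omega> then partial k f x else 0)"
      by eventually_elim (auto intro!: limI diff_quot_tendsto_partial s)
  qed
qed

lemma partial_eq_0:
  assumes "open U" "x \<in> U" "\<And>y. y \<in> U \<Longrightarrow> f y = 0"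
  shows "partial k f x = 0"
proof -
  have "(f has_derivative (\<lambda>_. 0)) (at x)"
    by (rule has_derivative_transform_within_open[OF has_derivative_const[of 0] assms(1,2)])
       (simp add: assms(3))
  then show ?thesis
    unfolding partial_def by (simp add: frechet_derivative_at[symmetric])
qed

section \<open>Passage to the limit in the exchange identity\<close>

lemma integrable_lebesgue_bounded_support:
  fixes q :: "'a::euclidean_space \<Rightarrow> real"
  assumes "q \<in> borel_measurable lebesgue" "bounded K" "\<And>x. x \<notin> K \<Longrightarrow> q x = 0"
    and "AE x in lebesgue. \<bar>q x\<bar> \<le> B"
  shows "integrable lebesgue q"
proof -
  \<comment> \<open>\<open>K\<close> is not assumed measurable, so a ball around it carries the
    dominating function.\<close>
  obtain R where R: "K \<subseteq> cball 0 R"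
    using assms(2) bounded_subset_ballD[of K 0] ball_subset_cball by blast
  show ?thesis
  proof (rule Bochner_Integration.integrable_bound)
    show "integrable lebesgue (\<lambda>x. B * indicator (cball 0 R) x)"
      by (intro integrable_mult_right) (simp flip: lmeasurable_iff_integrable)
    show "AE x in lebesgue. norm (q x) \<le> norm (B * indicator (cball 0 R) x)"
      using assms(4)
    proof eventually_elim
      case (elim x)
      then show ?case using assms(3)[of x] R by (cases "x \<in> K") (auto simp: indicator_def)
    qed
  qed (rule assms)
qed

text \<open>The point is a majorant independent of n. Outside a neighbourhood of \<open>K\<close>
  the quotient of \<open>h\<close> is zero, so \<open>g\<close> is only ever compared along segments
  inside \<Omega>, where its Lipschitz bound applies.\<close>

lemma integral_diff_quot_tendsto:
  fixes g h :: "real^'n \<Rightarrow> real"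
  assumes reg: "weakly_regular \<Omega> g" "weakly_regular \<Omega> h" and "open \<Omega>"
    and K: "compact K" "\<And>x. x \<notin> K \<Longrightarrow> h x = 0"
    and e: "0 < e" "(\<Union>x\<in>K. cball x e) \<subseteq> \<Omega>"
    and s: "s \<longlonglongrightarrow> 0" "\<And>n. s n \<noteq> 0" "\<And>n. \<bar>s n\<bar> \<le> e / 2"
  shows "(\<lambda>n. \<integral>x. diff_quot a (s n) g x * diff_quot b (s n) h x \<partial>lborel)
           \<longlonglongrightarrow> (\<integral>x. partial a g x * partial b h x \<partial>lebesgue)"
proof -
  have [measurable]: "g \<in> borel_measurable borel" "h \<in> borel_measurable borel"
    using reg unfolding weakly_regular_def by auto
  obtain C where C0: "0 \<le> C"
    and C: "\<And>x y. closed_segment x y \<subseteq> \<Omega> \<Longrightarrow> \<bar>g x - g y\<bar> \<le> C * dist x y"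
    using weakly_regular_lipschitz[OF reg(1)] by blast
  obtain D where D0: "0 \<le> D"
    and D: "\<And>x y. closed_segment x y \<subseteq> \<Omega> \<Longrightarrow> \<bar>h x - h y\<bar> \<le> D * dist x y"
    using weakly_regular_lipschitz[OF reg(2)] by blast
  obtain R where R: "K \<subseteq> cball 0 R"
    using compact_imp_bounded[OF K(1)] bounded_subset_ballD[of K 0] ball_subset_cball by blast
  let ?q = "\<lambda>n x. diff_quot a (s n) g x * diff_quot b (s n) h x"
  \<comment> \<open>The margin e is split in two: a nonzero quotient puts x within
    \<open>e / 2\<close> of \<open>K\<close>, and the step adds at most another
    \<open>e / 2\<close>, so the ball of radius \<open>\<bar>s n\<bar>\<close> around x stays in the
    e-neighbourhood of \<open>K\<close>.\<close>
  have near: "\<exists>y\<in>K. dist y x \<le> e / 2" if "diff_quot b (s n) h x \<noteq> 0" for n x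
  proof (cases "x \<in> K")
    case False
    then have "x + s n *\<^sub>R axis b 1 \<in> K"
      using that K(2) unfolding diff_quot_def by fastforce
    then show ?thesis using s(3)[of n] by (intro bexI) (auto simp: dist_norm)
  qed (use e in force)
  have bound: "\<bar>?q n x\<bar> \<le> C * D * indicator (cball 0 (R + e)) x" for n x
  proof (cases "diff_quot b (s n) h x = 0")
    case True
    then show ?thesis using C0 D0 by (simp add: indicator_def)
  next
    case False
    then obtain y where y: "y \<in> K" "dist y x \<le> e / 2" using near by blast
    have "cball x \<bar>s n\<bar> \<subseteq> cball y e"
    proof
      fix z assume "z \<in> cball x \<bar>s n\<bar>"
      then show "z \<in> cball y e"
        using s(3)[of n] y(2) dist_triangle[of y z x] by simp
    qed
    then have "cball x \<bar>s n\<bar> \<subseteq> \<Omega>" using e(2) y(1) by blast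
    then have "\<bar>diff_quot a (s n) g x\<bar> \<le> C" "\<bar>diff_quot b (s n) h x\<bar> \<le> D"
      using diff_quot_bound[OF C] diff_quot_bound[OF D] s(2) by blast+
    then have "\<bar>?q n x\<bar> \<le> C * D"
      unfolding abs_mult by (intro mult_mono) auto
    moreover have "x \<in> cball 0 (R + e)"
      using y R e(1) dist_triangle[of 0 x y] by (force simp: mem_cball)
    ultimately show ?thesis by (simp add: indicator_def)
  qed
  have off: "partial b h x = 0" if "x \<notin> \<Omega>" for x
  proof (rule partial_eq_0[of "- K"])
    show "open (- K)" using K compact_imp_closed by blast
    show "x \<in> - K" using that e by force
  qed (use K in auto)
  have "(\<lambda>n. \<integral>x. ?q n x \<partial>lebesgue) \<longlonglongrightarrow> (\<integral>x. partial a g x * partial b h x \<partial>lebesgue)"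
  proof (rule integral_dominated_convergence)
    have "(\<lambda>x. (if x \<in> \<Omega> then partial a g x else 0) * (if x \<in> \<Omega> then partial b h x else 0))
        \<in> borel_measurable lebesgue"
      using assms by (intro borel_measurable_times weakly_regular_partial_measurable)
    also have "(\<lambda>x. (if x \<in> \<Omega> then partial a g x else 0) * (if x \<in> \<Omega> then partial b h x else 0))
        = (\<lambda>x. partial a g x * partial b h x)"
      using off by auto
    finally show "(\<lambda>x. partial a g x * partial b h x) \<in> borel_measurable lebesgue" .
    show "?q n \<in> borel_measurable lebesgue" for n
    proof (rule measurable_completion)
      show "?q n \<in> borel_measurable lborel" unfolding diff_quot_def by measurable
    qed
    show "integrable lebesgue (\<lambda>x. C * D * indicator (cball 0 (R + e)) x)"
      by (intro integrable_mult_right) (simp flip: lmeasurable_iff_integrable)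
    show "AE x in lebesgue. norm (?q n x) \<le> C * D * indicator (cball 0 (R + e)) x" for n
      using bound by simp
    have "AE x in lebesgue. x \<in> \<Omega> \<longrightarrow> g differentiable (at x)"
         "AE x in lebesgue. x \<in> \<Omega> \<longrightarrow> h differentiable (at x)"
      using reg unfolding weakly_regular_def by blast+
    then show "AE x in lebesgue. (\<lambda>n. ?q n x) \<longlonglongrightarrow> partial a g x * partial b h x"
    proof eventually_elim
      case (elim x)
      show ?case
      proof (cases "x \<in> \<Omega>")
        case True
        then show ?thesis using elim by (intro tendsto_mult diff_quot_tendsto_partial s) auto
      next
        case False
        \<comment> \<open>Off \<Omega> nothing is known about \<open>g\<close>. The other factor is
          identically zero there, by \<open>near\<close>, so the product converges
          trivially.\<close>
        have "diff_quot b (s n) h x = 0" for n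
        proof (rule ccontr)
          assume "diff_quot b (s n) h x \<noteq> 0"
          then obtain y where "y \<in> K" "dist y x \<le> e / 2" using near by blast
          then have "x \<in> (\<Union>x\<in>K. cball x e)" using e(1) by force
          then show False using e(2) False by blast
        qed
        then show ?thesis using off[OF False] by simp
      qed
    qed
  qed
  \<comment> \<open>The limit is only Lebesgue measurable, while translation was done for Borel
    functions; both measures give the Borel quotients the same integral.\<close>
  moreover have "(\<integral>x. ?q n x \<partial>lebesgue) = (\<integral>x. ?q n x \<partial>lborel)" for n
  proof (rule integral_completion)
    show "?q n \<in> borel_measurable lborel" unfolding diff_quot_def by measurable
  qed
  ultimately show ?thesis by simp
qed

text \<open>This is the weak form of the symmetry of second derivatives.\<close>

lemma integral_partial_exchange:
  fixes g h :: "real^'n \<Rightarrow> real"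
  assumes reg: "weakly_regular \<Omega> g" "weakly_regular \<Omega> h" and "open \<Omega>"
    and K: "compact K" "K \<subseteq> \<Omega>" "\<And>x. x \<notin> K \<Longrightarrow> h x = 0"
  shows "(\<integral>x. partial a g x * partial b h x \<partial>lebesgue) = (\<integral>x. partial b g x * partial a h x \<partial>lebesgue)"
proof -
  \<comment> \<open>Compactness of \<open>K\<close> gives one margin valid at all its
    points.\<close>
  obtain e where e: "0 < e" "(\<Union>x\<in>K. cball x e) \<subseteq> \<Omega>"
    using compact_subset_open_imp_cball_epsilon_subset[OF K(1) \<open>open \<Omega>\<close> K(2)] by blast
  obtain s where s: "s \<longlonglongrightarrow> 0" "\<And>n::nat. s n \<noteq> 0" "\<And>n. \<bar>s n\<bar> \<le> e / 2"
    using null_sequence_below[of "e / 2"] e(1) by auto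
  have m[measurable]: "g \<in> borel_measurable borel" "h \<in> borel_measurable borel"
    using reg unfolding weakly_regular_def by auto
  obtain B where B: "\<And>x. \<bar>g x\<bar> \<le> B"
    using reg unfolding weakly_regular_def by blast
  obtain B' where B': "\<And>x. \<bar>h x\<bar> \<le> B'"
    using reg unfolding weakly_regular_def by blast
  have hm: "h \<in> borel_measurable lborel" by simp
  have "integrable lebesgue h"
    by (rule integrable_lebesgue_bounded_support
          [where B = B', OF measurable_completion[OF hm] compact_imp_bounded[OF K(1)] K(3)])
       (simp_all add: B')
  then have h: "integrable lborel h"
    unfolding integrable_completion[OF hm] .
  \<comment> \<open>The exchanged side runs along \<open>- s n\<close>, again a null sequence of
    nonzero steps of the same size.\<close>
  have lim: "(\<lambda>n. \<integral>x. diff_quot b (- s n) g x * diff_quot a (- s n) h x \<partial>lborel)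
          \<longlonglongrightarrow> (\<integral>x. partial b g x * partial a h x \<partial>lebesgue)"
    by (rule integral_diff_quot_tendsto[OF reg \<open>open \<Omega>\<close> K(1,3) e])
       (use s tendsto_minus[OF s(1)] in simp_all)
  have lim': "(\<lambda>n. \<integral>x. diff_quot a (s n) g x * diff_quot b (s n) h x \<partial>lborel)
          \<longlonglongrightarrow> (\<integral>x. partial a g x * partial b h x \<partial>lebesgue)"
    using integral_diff_quot_tendsto[OF reg \<open>open \<Omega>\<close> K(1,3) e s] .
  have eq: "(\<lambda>n. \<integral>x. diff_quot a (s n) g x * diff_quot b (s n) h x \<partial>lborel)
      = (\<lambda>n. \<integral>x. diff_quot b (- s n) g x * diff_quot a (- s n) h x \<partial>lborel)"
    by (rule ext) (rule integral_diff_quot_exchange[OF m B h])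
  show ?thesis
    by (rule LIMSEQ_unique[OF lim' lim[folded eq]])
qed

section \<open>Weak curl of a scaled gradient\<close>

lemma test_functionD:
  assumes "\<phi> \<in> test_functions \<Omega>"
  shows "\<phi> differentiable (at x)" "partial k \<phi> differentiable (at x)"
    "continuous_on UNIV \<phi>" "continuous_on UNIV (partial k \<phi>)"
    "\<phi> \<in> borel_measurable borel" "partial k \<phi> \<in> borel_measurable borel"
proof -
  have "iter_partial [] \<phi> differentiable_on UNIV" "iter_partial [k] \<phi> differentiable_on UNIV"
    using assms unfolding test_functions_def by blast+
  then have *: "\<phi> differentiable_on UNIV" "partial k \<phi> differentiable_on UNIV"
    by simp_all
  then show "\<phi> differentiable (at x)" "partial k \<phi> differentiable (at x)"
    by (simp_all add: differentiable_on_def)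
  show c: "continuous_on UNIV \<phi>" "continuous_on UNIV (partial k \<phi>)"
    using * differentiable_imp_continuous_on by blast+
  show "\<phi> \<in> borel_measurable borel" "partial k \<phi> \<in> borel_measurable borel"
    using c borel_measurable_continuous_onI by blast+
qed

text \<open>One compact set serves for \<phi> and all its partial derivatives, because \<phi> is
  identically zero on the open complement.\<close>

lemma test_function_support:
  assumes "\<phi> \<in> test_functions \<Omega>"
  obtains K where "compact K" "K \<subseteq> \<Omega>" "\<And>x. x \<notin> K \<Longrightarrow> \<phi> x = 0" "\<And>k x. x \<notin> K \<Longrightarrow> partial k \<phi> x = 0"
proof -
  define K where "K = closure {x. \<phi> x \<noteq> 0}"
  have K: "compact K" "K \<subseteq> \<Omega>"
    using assms unfolding test_functions_def K_def by blast+
  have z: "\<phi> x = 0" if "x \<notin> K" for x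
  proof (rule ccontr)
    assume "\<phi> x \<noteq> 0"
    then have "x \<in> K" unfolding K_def by (intro subsetD[OF closure_subset]) simp
    with that show False ..
  qed
  have "partial k \<phi> x = 0" if "x \<notin> K" for k x
  proof (rule partial_eq_0[of "- K"])
    show "open (- K)" using compact_imp_closed[OF K(1)] by (simp add: open_Compl)
  qed (simp_all add: that z)
  with that[OF K z] show thesis by metis
qed

lemma continuous_compact_support_bounded:
  fixes q :: "'a::topological_space \<Rightarrow> real"
  assumes "continuous_on UNIV q" "compact K" "\<And>x. x \<notin> K \<Longrightarrow> q x = 0"
  obtains B where "\<And>x. \<bar>q x\<bar> \<le> B"
proof -
  have "compact (q ` K)"
    using assms compact_continuous_image continuous_on_subset by blast
  then obtain B where B: "\<forall>y\<in>q ` K. norm y \<le> B"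
    using compact_imp_bounded bounded_iff by metis
  show thesis
  proof (rule that[of "max B 0"])
    show "\<bar>q x\<bar> \<le> max B 0" for x
      using B assms(3)[of x] by (cases "x \<in> K") force+
  qed
qed

lemma test_function_bounded:
  assumes "\<phi> \<in> test_functions \<Omega>"
  obtains B where "\<And>x. \<bar>\<phi> x\<bar> \<le> B"
proof -
  obtain K where "compact K" "\<And>x. x \<notin> K \<Longrightarrow> \<phi> x = 0"
    using test_function_support[OF assms] by metis
  then show thesis
    by (rule continuous_compact_support_bounded[OF test_functionD(3)[OF assms] _ _ that])
qed

lemma test_function_partial_bounded:
  assumes "\<phi> \<in> test_functions \<Omega>"
  obtains B where "\<And>x. \<bar>partial k \<phi> x\<bar> \<le> B"
proof -
  obtain K where "compact K" "\<And>x. x \<notin> K \<Longrightarrow> partial k \<phi> x = 0"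
    using test_function_support[OF assms] by metis
  then show thesis
    by (rule continuous_compact_support_bounded[OF test_functionD(4)[OF assms] _ _ that])
qed

text \<open>Mean value inequality on the whole space: expanding a vector in the standard basis
  bounds the operator norm of the derivative by the sum of the bounds of the partial
  derivatives.\<close>

lemma test_function_lipschitz:
  fixes \<phi> :: "real^'n \<Rightarrow> real"
  assumes "\<phi> \<in> test_functions \<Omega>"
  obtains C where "\<And>x y. \<bar>\<phi> x - \<phi> y\<bar> \<le> C * dist x y"
proof -
  obtain B where B: "\<And>k x. \<bar>partial k \<phi> x\<bar> \<le> B k"
  proof -
    have "\<forall>k. \<exists>B. \<forall>x. \<bar>partial k \<phi> x\<bar> \<le> B"
      using test_function_partial_bounded[OF assms] by metis
    then show thesis using that by metis
  qed
  have "norm (\<phi> x - \<phi> y) \<le> sum B UNIV * norm (x - y)" for x y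
  proof (rule differentiable_bound[of UNIV \<phi> "\<lambda>x. frechet_derivative \<phi> (at x)"])
    fix x
    have D: "(\<phi> has_derivative frechet_derivative \<phi> (at x)) (at x)"
      using test_functionD(1)[OF assms] frechet_derivative_works by blast
    then show "(\<phi> has_derivative frechet_derivative \<phi> (at x)) (at x within UNIV)"
      by simp
    show "onorm (frechet_derivative \<phi> (at x)) \<le> sum B UNIV"
    proof (rule onorm_le)
      fix v :: "real^'n"
      have lin: "linear (frechet_derivative \<phi> (at x))"
        using D has_derivative_linear by blast
      have "frechet_derivative \<phi> (at x) v
          = frechet_derivative \<phi> (at x) (\<Sum>k\<in>UNIV. v $ k *\<^sub>R axis k 1)"
        by (simp add: basis_expansion scalar_mult_eq_scaleR[symmetric])
      also have "\<dots> = (\<Sum>k\<in>UNIV. v $ k * partial k \<phi> x)"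
        by (simp add: linear_sum[OF lin] linear_scale[OF lin] partial_def)
      finally have "norm (frechet_derivative \<phi> (at x) v) \<le> (\<Sum>k\<in>UNIV. \<bar>v $ k * partial k \<phi> x\<bar>)"
        by simp
      also have "\<dots> \<le> (\<Sum>k\<in>UNIV. norm v * B k)"
        unfolding abs_mult by (intro sum_mono mult_mono B component_le_norm_cart) auto
      finally show "norm (frechet_derivative \<phi> (at x) v) \<le> sum B UNIV * norm v"
        by (simp add: sum_distrib_left mult.commute)
    qed
  qed auto
  then show thesis
    by (intro that[of "sum B UNIV"]) (simp add: dist_norm)
qed

text \<open>This admits f \<phi> as the function \<open>h\<close> of
  \<open>integral_partial_exchange\<close>. The Lipschitz constant comes from f(x) (\<phi>(x) -
  \<phi>(y)) + (f(x) - f(y)) \<phi>(y).\<close>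

lemma weakly_regular_times_test_function:
  assumes f: "weakly_regular \<Omega> f" and \<phi>: "\<phi> \<in> test_functions \<Omega>"
  shows "weakly_regular \<Omega> (\<lambda>x. f x * \<phi> x)"
proof -
  obtain B where B: "\<And>x. \<bar>f x\<bar> \<le> B"
    using f unfolding weakly_regular_def by blast
  obtain C where "0 \<le> C" and C: "\<And>x y. closed_segment x y \<subseteq> \<Omega> \<Longrightarrow> \<bar>f x - f y\<bar> \<le> C * dist x y"
    using weakly_regular_lipschitz[OF f] by metis
  obtain B' where B': "\<And>x. \<bar>\<phi> x\<bar> \<le> B'" using test_function_bounded[OF \<phi>] by metis
  obtain C' where C': "\<And>x y. \<bar>\<phi> x - \<phi> y\<bar> \<le> C' * dist x y"
    using test_function_lipschitz[OF \<phi>] by metis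
  have B0: "0 \<le> B" "0 \<le> B'"
    using order_trans[OF abs_ge_zero B] order_trans[OF abs_ge_zero B'] .
  have "f \<in> borel_measurable borel" using f unfolding weakly_regular_def by blast
  then have "(\<lambda>x. f x * \<phi> x) \<in> borel_measurable borel"
    using test_functionD(5)[OF \<phi>] by simp
  moreover have "\<bar>f x * \<phi> x\<bar> \<le> B * B'" for x
    unfolding abs_mult by (intro mult_mono B B' B0) simp
  moreover have "\<bar>f x * \<phi> x - f y * \<phi> y\<bar> \<le> (B * C' + C * B') * dist x y" if "closed_segment x y \<subseteq> \<Omega>" for x y
  proof -
    have "\<bar>f x * \<phi> x - f y * \<phi> y\<bar> = \<bar>f x * (\<phi> x - \<phi> y) + (f x - f y) * \<phi> y\<bar>"
      by (simp add: algebra_simps)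
    also have "\<dots> \<le> \<bar>f x\<bar> * \<bar>\<phi> x - \<phi> y\<bar> + \<bar>f x - f y\<bar> * \<bar>\<phi> y\<bar>"
      using abs_triangle_ineq by (metis abs_mult)
    also have "\<dots> \<le> B * (C' * dist x y) + (C * dist x y) * B'"
      using C[OF that] by (intro add_mono mult_mono B B' C' B0) (auto intro: order_trans[OF abs_ge_zero])
    finally show ?thesis by (simp add: algebra_simps)
  qed
  moreover have "AE x in lebesgue. x \<in> \<Omega> \<longrightarrow> f differentiable (at x)"
    using f unfolding weakly_regular_def by blast
  then have "AE x in lebesgue. x \<in> \<Omega> \<longrightarrow> (\<lambda>x. f x * \<phi> x) differentiable (at x)"
    by eventually_elim (use test_functionD(1)[OF \<phi>] in \<open>blast intro: differentiable_mult\<close>)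
  ultimately show ?thesis
    unfolding weakly_regular_def by blast
qed

section \<open>Product rule under the integral\<close>

lemma partial_mult:
  assumes "f differentiable (at x)" "g differentiable (at x)"
  shows "partial k (\<lambda>x. f x * g x) x = f x * partial k g x + partial k f x * g x"
proof -
  have "((\<lambda>x. f x * g x) has_derivative
     (\<lambda>h. f x * frechet_derivative g (at x) h + frechet_derivative f (at x) h * g x)) (at x)"
    using assms frechet_derivative_works by (intro has_derivative_mult) auto
  from frechet_derivative_at[OF this] show ?thesis
    unfolding partial_def by metis
qed

text \<open>In the applications q is built from partial derivatives, which are controlled on
  \<Omega> only; hence the truncation in the hypothesis. The factor \<psi> vanishes off \<Omega>, so
  the truncation disappears from the product.\<close>

lemma integrable_times_compact_support:
  fixes q \<psi> :: "real^'n \<Rightarrow> real"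
  assumes q: "(\<lambda>x. if x \<in> \<Omega> then q x else 0) \<in> borel_measurable lebesgue"
    "AE x in lebesgue. x \<in> \<Omega> \<longrightarrow> \<bar>q x\<bar> \<le> B"
    and \<psi>: "continuous_on UNIV \<psi>" "compact K" "K \<subseteq> \<Omega>" "\<And>x. x \<notin> K \<Longrightarrow> \<psi> x = 0"
  shows "integrable lebesgue (\<lambda>x. q x * \<psi> x)"
proof -
  obtain C where C: "\<And>x. \<bar>\<psi> x\<bar> \<le> C"
    using continuous_compact_support_bounded[OF \<psi>(1,2,4)] by metis
  show ?thesis
  proof (rule integrable_lebesgue_bounded_support[of _ K "\<bar>B\<bar> * C"])
    have "\<psi> \<in> borel_measurable lborel"
      using borel_measurable_continuous_onI[OF \<psi>(1)] by simp
    then have "(\<lambda>x. (if x \<in> \<Omega> then q x else 0) * \<psi> x) \<in> borel_measurable lebesgue"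
      using q(1) measurable_completion by (intro borel_measurable_times)
    also have "(\<lambda>x. (if x \<in> \<Omega> then q x else 0) * \<psi> x) = (\<lambda>x. q x * \<psi> x)"
    proof
      show "(if x \<in> \<Omega> then q x else 0) * \<psi> x = q x * \<psi> x" for x
        using \<psi>(4)[of x] subsetD[OF \<psi>(3), of x] by (cases "x \<in> \<Omega>") auto
    qed
    finally show "(\<lambda>x. q x * \<psi> x) \<in> borel_measurable lebesgue" .
    show "AE x in lebesgue. \<bar>q x * \<psi> x\<bar> \<le> \<bar>B\<bar> * C"
      using q(2)
    proof eventually_elim
      case (elim x)
      show ?case
      proof (cases "x \<in> K")
        case True
        with elim subsetD[OF \<psi>(3)] have "\<bar>q x\<bar> \<le> \<bar>B\<bar>" by force
        then show ?thesis unfolding abs_mult by (intro mult_mono C) auto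
      next
        case False
        have "0 \<le> C" by (rule order_trans[OF abs_ge_zero C])
        then show ?thesis using \<psi>(4)[OF False] by simp
      qed
    qed
    show "bounded K" by (rule compact_imp_bounded[OF \<psi>(2)])
  qed (simp add: \<psi>(4))
qed

text \<open>The two terms have different roles: the one with \<open>partial b \<phi>\<close> is, up
  to sign, the distributional derivative of f times \<open>partial a g\<close>, and the one with
  \<phi> supplies the candidate curl. Each is integrable on its own, so the integral splits.\<close>

lemma integral_partial_product_rule:
  fixes f g :: "real^'n \<Rightarrow> real"
  assumes f: "weakly_regular \<Omega> f" and g: "weakly_regular \<Omega> g" and \<Omega>: "open \<Omega>"
    and \<phi>: "\<phi> \<in> test_functions \<Omega>"
  shows "integrable lebesgue (\<lambda>x. f x * partial a g x * partial b \<phi> x)"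
    and "integrable lebesgue (\<lambda>x. partial a g x * partial b f x * \<phi> x)"
    and "(\<integral>x. partial a g x * partial b (\<lambda>x. f x * \<phi> x) x \<partial>lebesgue)
      = (\<integral>x. f x * partial a g x * partial b \<phi> x \<partial>lebesgue)
        + (\<integral>x. partial a g x * partial b f x * \<phi> x \<partial>lebesgue)"
proof -
  obtain K where K: "compact K" "K \<subseteq> \<Omega>" "\<And>x. x \<notin> K \<Longrightarrow> \<phi> x = 0"
      "\<And>x. x \<notin> K \<Longrightarrow> partial b \<phi> x = 0"
    using test_function_support[OF \<phi>] by metis
  obtain B where B: "\<And>x. \<bar>f x\<bar> \<le> B"
    using f unfolding weakly_regular_def by blast
  obtain C where C: "AE x in lebesgue. x \<in> \<Omega> \<longrightarrow> \<bar>partial a g x\<bar> \<le> C"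
    using weakly_regular_partial_bound[OF g \<Omega>] by metis
  obtain D where D: "AE x in lebesgue. x \<in> \<Omega> \<longrightarrow> \<bar>partial b f x\<bar> \<le> D"
    using weakly_regular_partial_bound[OF f \<Omega>] by metis
  have fm: "f \<in> borel_measurable lebesgue"
    using f by (intro measurable_completion) (simp add: weakly_regular_def)
  note mg = weakly_regular_partial_measurable[OF g \<Omega>, of a]
    and mf = weakly_regular_partial_measurable[OF f \<Omega>, of b]
  show i1: "integrable lebesgue (\<lambda>x. f x * partial a g x * partial b \<phi> x)"
  proof (rule integrable_times_compact_support[OF _ _ test_functionD(4)[OF \<phi>] K(1,2,4)])
    have "(\<lambda>x. f x * (if x \<in> \<Omega> then partial a g x else 0)) \<in> borel_measurable lebesgue"
      by (intro borel_measurable_times fm mg)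
    \<comment> \<open>The two functions coincide pointwise, and measurability is transported along
      this equality.\<close>
    then show "(\<lambda>x. if x \<in> \<Omega> then f x * partial a g x else 0) \<in> borel_measurable lebesgue"
      by (rule arg_cong2[of _ _ _ _ "(\<in>)", THEN iffD1, rotated 2]) auto
    show "AE x in lebesgue. x \<in> \<Omega> \<longrightarrow> \<bar>f x * partial a g x\<bar> \<le> B * C"
      using C
    proof eventually_elim
      case (elim x)
      have "0 \<le> B" using B[of x] by simp
      then show ?case using elim B[of x] unfolding abs_mult by (auto intro!: mult_mono)
    qed
  qed
  show i2: "integrable lebesgue (\<lambda>x. partial a g x * partial b f x * \<phi> x)"
  proof (rule integrable_times_compact_support[OF _ _ test_functionD(3)[OF \<phi>] K(1,2,3)])
    have "(\<lambda>x. (if x \<in> \<Omega> then partial a g x else 0) * (if x \<in> \<Omega> then partial b f x else 0)) \<in> borel_measurable lebesgue"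
      by (intro borel_measurable_times mg mf)
    then show "(\<lambda>x. if x \<in> \<Omega> then partial a g x * partial b f x else 0) \<in> borel_measurable lebesgue"
      by (rule arg_cong2[of _ _ _ _ "(\<in>)", THEN iffD1, rotated 2]) auto
    show "AE x in lebesgue. x \<in> \<Omega> \<longrightarrow> \<bar>partial a g x * partial b f x\<bar> \<le> C * D"
      using C D
    proof eventually_elim
      case (elim x)
      show ?case
      proof
        assume "x \<in> \<Omega>"
        with elim have *: "\<bar>partial a g x\<bar> \<le> C" "\<bar>partial b f x\<bar> \<le> D" by auto
        show "\<bar>partial a g x * partial b f x\<bar> \<le> C * D"
          unfolding abs_mult using order_trans[OF abs_ge_zero *(1)] by (intro mult_mono *) auto
      qed
    qed
  qed
  let ?r = "\<lambda>x. f x * partial a g x * partial b \<phi> x + partial a g x * partial b f x * \<phi> x"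
  have "AE x in lebesgue. x \<in> \<Omega> \<longrightarrow> f differentiable (at x)"
    using f unfolding weakly_regular_def by blast
  then have ae: "AE x in lebesgue. ?r x = partial a g x * partial b (\<lambda>x. f x * \<phi> x) x"
  proof eventually_elim
    case (elim x)
    show ?case
    proof (cases "x \<in> \<Omega>")
      case True
      then show ?thesis
        using elim partial_mult[OF _ test_functionD(1)[OF \<phi>], of f x b] by (simp add: algebra_simps)
    next
      case False
      \<comment> \<open>Differentiability of f is unknown off \<Omega>, but f \<phi> is zero on the
        open complement of \<open>K\<close>, so its derivative vanishes without a product
        rule.\<close>
      have "partial b (\<lambda>x. f x * \<phi> x) x = 0"
      proof (rule partial_eq_0[of "- K"])
        show "open (- K)" using compact_imp_closed[OF K(1)] by blast
        show "x \<in> - K" using False K(2) by blast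
      qed (simp add: K(3))
      moreover have "\<phi> x = 0" "partial b \<phi> x = 0"
        using K(3,4) subsetD[OF K(2)] False by metis+
      ultimately show ?thesis by simp
    qed
  qed
  have r: "?r \<in> borel_measurable lebesgue"
    using i1 i2 by auto
  have "(\<integral>x. partial a g x * partial b (\<lambda>x. f x * \<phi> x) x \<partial>lebesgue) = integral\<^sup>L lebesgue ?r"
    by (rule integral_cong_AE[symmetric, OF r borel_measurable_AE[OF r ae] ae])
  also have "\<dots> = (\<integral>x. f x * partial a g x * partial b \<phi> x \<partial>lebesgue)
        + (\<integral>x. partial a g x * partial b f x * \<phi> x \<partial>lebesgue)"
    by (rule Bochner_Integration.integral_add[OF i1 i2])
  finally show "(\<integral>x. partial a g x * partial b (\<lambda>x. f x * \<phi> x) x \<partial>lebesgue) = \<dots>" .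
qed

text \<open>Converts the integrals over \<Omega> in the distributional pairings into integrals over
  the whole space. Measurability of q on S is a consequence, by completeness.\<close>

lemma integral_lebesgue_on_cong_AE:
  fixes p q :: "real^'n \<Rightarrow> real"
  assumes S: "S \<in> sets lebesgue" and p: "p \<in> borel_measurable lebesgue" "\<And>x. x \<notin> S \<Longrightarrow> p x = 0"
    and ae: "AE x in lebesgue. x \<in> S \<longrightarrow> q x = p x"
  shows "(\<integral>x. q x \<partial>lebesgue_on S) = (\<integral>x. p x \<partial>lebesgue)"
proof -
  have ae': "AE x in lebesgue. p x = indicator S x *\<^sub>R q x"
    using ae by eventually_elim (auto simp: indicator_def p(2))
  have "(\<integral>x. q x \<partial>lebesgue_on S) = (\<integral>x. indicator S x *\<^sub>R q x \<partial>lebesgue)"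
    by (rule integral_restrict_space) (simp add: S)
  also have "\<dots> = (\<integral>x. p x \<partial>lebesgue)"
    by (rule integral_cong_AE[symmetric, OF p(1) borel_measurable_AE[OF p(1) ae'] ae'])
  finally show ?thesis .
qed

text \<open>The scalar distribution
  \<open>\<partial>\<^sub>b F\<^sub>a - \<partial>\<^sub>a F\<^sub>b\<close> is represented by g. Up
  to sign, every component of the curl in the plane and in space has this form, so both dimensions
  share one argument.\<close>

definition weak_curl ::
    "(real^'n) set \<Rightarrow> 'n \<Rightarrow> 'n \<Rightarrow> (real^'n \<Rightarrow> real^'n) \<Rightarrow> (real^'n \<Rightarrow> real) \<Rightarrow> bool" where
  "weak_curl \<Omega> a b F g \<longleftrightarrow> (\<forall>\<phi>\<in>test_functions \<Omega>. (\<integral>x. g x * \<phi> x \<partial>lebesgue_on \<Omega>)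
     = dist_partial \<Omega> b (\<lambda>x. F x $ a) \<phi> - dist_partial \<Omega> a (\<lambda>x. F x $ b) \<phi>)"

text \<open>Formally the second derivatives of g cancel and only products of first derivatives
  remain. Weakly, the cancellation is \<open>integral_partial_exchange\<close> applied to g and f
  \<phi>: the sum of the integrals of \<open>?P a b\<close> and \<open>?Q a b\<close> is symmetric
  in a and b. G and H are prescribed almost everywhere only, to fit
  \<open>cellwise_grad\<close>.\<close>

lemma weak_curl_scaled_gradient:
  fixes f g :: "real^'n \<Rightarrow> real" and G H :: "real^'n \<Rightarrow> real^'n"
  assumes f: "weakly_regular \<Omega> f" and g: "weakly_regular \<Omega> g" and \<Omega>: "open \<Omega>"
    and G: "AE x in lebesgue. x \<in> \<Omega> \<longrightarrow> G x = (\<chi> k. partial k g x)"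
    and H: "AE x in lebesgue. x \<in> \<Omega> \<longrightarrow> H x = (\<chi> k. partial k f x)"
  shows "weak_curl \<Omega> a b (\<lambda>x. f x *\<^sub>R G x) (\<lambda>x. G x $ a * H x $ b - G x $ b * H x $ a)"
  unfolding weak_curl_def
proof
  fix \<phi> assume \<phi>: "\<phi> \<in> test_functions \<Omega>"
  obtain K where K: "compact K" "K \<subseteq> \<Omega>" "\<And>x. x \<notin> K \<Longrightarrow> \<phi> x = 0"
      "\<And>k x. x \<notin> K \<Longrightarrow> partial k \<phi> x = 0"
    using test_function_support[OF \<phi>] by metis
  have S: "\<Omega> \<in> sets lebesgue" using \<Omega> by simp
  have off: "\<phi> x = 0" "partial k \<phi> x = 0" if "x \<notin> \<Omega>" for k x
    using K(3,4) subsetD[OF K(2)] that by metis+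
  let ?P = "\<lambda>a b x. f x * partial a g x * partial b \<phi> x"
  let ?Q = "\<lambda>a b x. partial a g x * partial b f x * \<phi> x"
  note P = integral_partial_product_rule(1)[OF f g \<Omega> \<phi>]
    and Q = integral_partial_product_rule(2)[OF f g \<Omega> \<phi>]
    and sum = integral_partial_product_rule(3)[OF f g \<Omega> \<phi>]
  have "integral\<^sup>L lebesgue (?P a b) + integral\<^sup>L lebesgue (?Q a b)
      = integral\<^sup>L lebesgue (?P b a) + integral\<^sup>L lebesgue (?Q b a)"
    unfolding sum[symmetric]
    by (rule integral_partial_exchange[OF g weakly_regular_times_test_function[OF f \<phi>] \<Omega> K(1,2)])
       (simp add: K(3))
  moreover have "dist_partial \<Omega> k (\<lambda>x. (f x *\<^sub>R G x) $ j) \<phi> = - integral\<^sup>L lebesgue (?P j k)" for j k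
    unfolding dist_partial_def
  proof (subst integral_lebesgue_on_cong_AE[OF S, of "?P j k"])
    show "?P j k \<in> borel_measurable lebesgue" using P by auto
    show "AE x in lebesgue. x \<in> \<Omega> \<longrightarrow> (f x *\<^sub>R G x) $ j * partial k \<phi> x = ?P j k x"
      using G by eventually_elim simp
  qed (simp_all add: off)
  moreover have "(\<integral>x. (G x $ a * H x $ b - G x $ b * H x $ a) * \<phi> x \<partial>lebesgue_on \<Omega>)
      = (\<integral>x. ?Q a b x - ?Q b a x \<partial>lebesgue)"
  proof (rule integral_lebesgue_on_cong_AE[OF S])
    show "(\<lambda>x. ?Q a b x - ?Q b a x) \<in> borel_measurable lebesgue"
      using Q by (intro borel_measurable_diff) auto
    show "AE x in lebesgue. x \<in> \<Omega> \<longrightarrow>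
        (G x $ a * H x $ b - G x $ b * H x $ a) * \<phi> x = ?Q a b x - ?Q b a x"
      using G H by eventually_elim (simp add: algebra_simps)
  qed (simp add: off)
  ultimately show "(\<integral>x. (G x $ a * H x $ b - G x $ b * H x $ a) * \<phi> x \<partial>lebesgue_on \<Omega>)
      = dist_partial \<Omega> b (\<lambda>x. (f x *\<^sub>R G x) $ a) \<phi> - dist_partial \<Omega> a (\<lambda>x. (f x *\<^sub>R G x) $ b) \<phi>"
    using Q by simp
qed

section \<open>Regularity of hat functions\<close>

lemma open_mesh_domain: "open (mesh_domain M)"
  by (simp add: mesh_domain_def)

lemma mesh_domain_subset: "mesh_domain M \<subseteq> \<Union>M"
  by (simp add: mesh_domain_def interior_subset)

lemma compact_Union_mesh: "polytopal_mesh M \<Longrightarrow> compact (\<Union>M)"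
  using mesh_cellD(3) by (intro compact_Union) (auto simp: polytopal_mesh_def)

lemma mesh_domain_lmeasurable:
  assumes "polytopal_mesh M"
  shows "mesh_domain M \<in> lmeasurable"
  by (rule bounded_set_imp_lmeasurable[OF bounded_subset[OF compact_imp_bounded[OF compact_Union_mesh[OF assms]]
        mesh_domain_subset]])
     (simp add: open_mesh_domain)

text \<open>Boundaries of convex sets are negligible, and there are finitely many cells.\<close>

lemma AE_mesh_domain_interior_cell:
  fixes M :: "'a::euclidean_space set set"
  assumes M: "polytopal_mesh M"
  shows "AE x in lebesgue. x \<in> mesh_domain M \<longrightarrow> (\<exists>m\<in>M. x \<in> interior m)"
proof -
  have "AE x in lebesgue. \<forall>m\<in>M. x \<notin> frontier m"
  proof (rule AE_finite_allI)
    show "finite M" using M by (simp add: polytopal_mesh_def)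
    fix m assume "m \<in> M"
    then have "negligible (frontier m)"
      using negligible_convex_frontier mesh_cellD(2)[OF M] by blast
    then show "AE x in lebesgue. x \<notin> frontier m"
      by (intro AE_not_in) (simp add: negligible_iff_null_sets)
  qed
  then show ?thesis
  proof eventually_elim
    case (elim x)
    show ?case
    proof
      assume "x \<in> mesh_domain M"
      then obtain m where m: "m \<in> M" "x \<in> m" using mesh_domain_subset by blast
      then have "x \<in> interior m"
        using elim closure_subset[of m] by (auto simp: frontier_def)
      with m show "\<exists>m\<in>M. x \<in> interior m" by blast
    qed
  qed
qed

lemma AE_cellwise_grad:
  assumes "polytopal_mesh M"
  shows "AE x in lebesgue. x \<in> mesh_domain M \<longrightarrow> cellwise_grad M f x = (\<chi> k. partial k f x)"
  using AE_mesh_domain_interior_cell[OF assms]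
  by eventually_elim (simp add: cellwise_grad_def)

text \<open>Along a segment the cells pull back to a finite closed cover of the unit interval. On an
  interval, Lipschitz bounds on the pieces of such a cover combine with the same constant, since
  lengths of consecutive pieces add up.\<close>

lemma lipschitz_on_segment_of_cover:
  fixes f :: "'a::euclidean_space \<Rightarrow> real"
  assumes M: "finite M" "\<And>m. m \<in> M \<Longrightarrow> closed m" "\<And>m. m \<in> M \<Longrightarrow> C-lipschitz_on m f" "0 \<le> C"
    and seg: "closed_segment x y \<subseteq> \<Union>M"
  shows "\<bar>f x - f y\<bar> \<le> C * dist x y"
proof -
  \<comment> \<open>Defined on the whole real line, so that the preimages of closed cells are closed
    in the reals.\<close>
  define \<gamma> where "\<gamma> t = x + t *\<^sub>R (y - x)" for t :: real
  have \<gamma>: "(dist x y)-lipschitz_on UNIV \<gamma>"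
  proof (rule lipschitz_onI)
    show "dist (\<gamma> s) (\<gamma> t) \<le> dist x y * dist s t" for s t
    proof -
      have "\<gamma> s - \<gamma> t = (s - t) *\<^sub>R (y - x)" by (simp add: \<gamma>_def algebra_simps)
      then show ?thesis by (simp add: dist_norm norm_minus_commute[of x])
    qed
  qed simp
  have "(C * dist x y)-lipschitz_on {0..1} (f \<circ> \<gamma>)"
  proof (rule lipschitz_on_closed_Union[of M _ "\<lambda>m. \<gamma> -` m"])
    show "(C * dist x y)-lipschitz_on (\<gamma> -` m) (f \<circ> \<gamma>)" if "m \<in> M" for m
    proof (rule lipschitz_on_compose)
      show "(dist x y)-lipschitz_on (\<gamma> -` m) \<gamma>" by (rule lipschitz_on_subset[OF \<gamma>]) simp
      show "C-lipschitz_on (\<gamma> ` (\<gamma> -` m)) f" by (rule lipschitz_on_subset[OF M(3)[OF that]]) blast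
    qed
    show "closed (\<gamma> -` m)" if "m \<in> M" for m
      by (rule closed_vimage[OF M(2)[OF that] lipschitz_on_continuous_on[OF \<gamma>]])
    show "{0..1} \<subseteq> (\<Union>m\<in>M. \<gamma> -` m)"
    proof
      fix t :: real assume "t \<in> {0..1}"
      then have "\<gamma> t \<in> closed_segment x y"
        unfolding closed_segment_def \<gamma>_def by (auto intro!: exI[of _ t] simp: algebra_simps)
      then show "t \<in> (\<Union>m\<in>M. \<gamma> -` m)" using seg by blast
    qed
  qed (use M in auto)
  from lipschitz_onD[OF this, of 0 1] show ?thesis
    by (simp add: \<gamma>_def dist_real_def)
qed

lemma hat_weakly_regular:
  fixes M :: "(real^'n) set set"
  assumes dim: "CARD('n) \<le> 3" and M: "polytopal_mesh M" and \<Lambda>: "mesh_coords M \<Lambda>"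
  shows "weakly_regular (mesh_domain M) (hat M \<Lambda> w)"
proof -
  have dim': "DIM(real^'n) \<le> 3" using dim by simp
  have fin: "finite M" using M by (simp add: polytopal_mesh_def)
  have cl: "closed m" if "m \<in> M" for m
    using mesh_cellD(3)[OF M that] compact_imp_closed by blast
  obtain C where C: "\<And>m. m \<in> M \<Longrightarrow> C-lipschitz_on m (hat M \<Lambda> w)" "0 \<le> C"
    using hat_lipschitz_on_cells[OF dim' M \<Lambda>] by metis
  have "continuous_on (\<Union>m\<in>M. m) (hat M \<Lambda> w)"
    by (rule continuous_on_closed_Union)
       (simp_all add: fin cl lipschitz_on_continuous_on[OF C(1)])
  then have cont: "continuous_on (\<Union>M) (hat M \<Lambda> w)"
    by simp
  have cpt: "compact (\<Union>M)" by (rule compact_Union_mesh[OF M])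
  \<comment> \<open>A hat function can jump to 0 at the outer boundary of the mesh; it is Borel as a
    continuous function on a compact set extended by 0.\<close>
  have "(\<lambda>x. indicator (\<Union>M) x *\<^sub>R hat M \<Lambda> w x) \<in> borel_measurable borel"
    by (intro borel_measurable_continuous_on_indicator borel_closed compact_imp_closed cpt cont)
  moreover have "(\<lambda>x. indicator (\<Union>M) x *\<^sub>R hat M \<Lambda> w x) = hat M \<Lambda> w"
    by (rule ext) (use hat_outside[of _ M \<Lambda> w] in \<open>auto simp: indicator_def\<close>)
  ultimately have 1: "hat M \<Lambda> w \<in> borel_measurable borel"
    by simp
  have 2: "\<exists>B. \<forall>x. \<bar>hat M \<Lambda> w x\<bar> \<le> B"
  proof -
    have "bounded (hat M \<Lambda> w ` \<Union>M)"
      by (rule compact_imp_bounded[OF compact_continuous_image[OF cont cpt]])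
    then obtain B where B: "\<forall>y\<in>hat M \<Lambda> w ` \<Union>M. norm y \<le> B"
      unfolding bounded_iff by blast
    have "\<bar>hat M \<Lambda> w x\<bar> \<le> \<bar>B\<bar>" for x
    proof (cases "x \<in> \<Union>M")
      case True
      then have "norm (hat M \<Lambda> w x) \<le> B" using B by blast
      then show ?thesis by simp
    next
      case False
      from hat_outside[OF this] show ?thesis by simp
    qed
    then show ?thesis by blast
  qed
  have 3: "\<exists>C. \<forall>x y. closed_segment x y \<subseteq> mesh_domain M \<longrightarrow> \<bar>hat M \<Lambda> w x - hat M \<Lambda> w y\<bar> \<le> C * dist x y"
  proof (intro exI allI impI)
    fix x y assume "closed_segment x y \<subseteq> mesh_domain M"
    then have seg: "closed_segment x y \<subseteq> \<Union>M" using mesh_domain_subset by blast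
    show "\<bar>hat M \<Lambda> w x - hat M \<Lambda> w y\<bar> \<le> C * dist x y"
      by (rule lipschitz_on_segment_of_cover[OF fin cl C seg])
  qed
  \<comment> \<open>In the interior of one cell the hat function coincides with a single coordinate
    or with 0, and derivatives at interior points see only that.\<close>
  have "AE x in lebesgue. \<forall>m\<in>M. x \<in> interior m \<longrightarrow> hat M \<Lambda> w differentiable (at x)"
  proof (rule AE_finite_allI[OF fin])
    fix m assume m: "m \<in> M"
    show "AE x in lebesgue. x \<in> interior m \<longrightarrow> hat M \<Lambda> w differentiable (at x)"
    proof (cases "w \<in> vertices m")
      case True
      then have "AE x in lebesgue. x \<in> interior m \<longrightarrow> \<Lambda> m w differentiable (at x)"
        using \<Lambda> m unfolding mesh_coords_def regular_coords_def by blast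
      then show ?thesis
      proof eventually_elim
        case (elim x)
        show ?case
        proof
          assume x: "x \<in> interior m"
          then obtain D where "(\<Lambda> m w has_derivative D) (at x)"
            using elim unfolding differentiable_def by blast
          then have "(hat M \<Lambda> w has_derivative D) (at x)"
            by (rule has_derivative_transform_within_open[OF _ open_interior x])
               (simp add: hat_eq[OF dim' M \<Lambda> m] True interior_subset[THEN subsetD])
          then show "hat M \<Lambda> w differentiable (at x)"
            unfolding differentiable_def by blast
        qed
      qed
    next
      case False
      have "hat M \<Lambda> w differentiable (at x)" if x: "x \<in> interior m" for x
      proof -
        have "(hat M \<Lambda> w has_derivative (\<lambda>_. 0)) (at x)"
          by (rule has_derivative_transform_within_open[OF has_derivative_const[of 0] open_interior x])
             (simp add: hat_eq[OF dim' M \<Lambda> m] False interior_subset[THEN subsetD])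
        then show ?thesis
          unfolding differentiable_def by blast
      qed
      then show ?thesis by simp
    qed
  qed
  with AE_mesh_domain_interior_cell[OF M]
  have "AE x in lebesgue. x \<in> mesh_domain M \<longrightarrow> hat M \<Lambda> w differentiable (at x)"
    by eventually_elim blast
  with 1 2 3 show ?thesis unfolding weakly_regular_def by blast
qed

section \<open>The space of fields with square integrable curl\<close>

lemma L2_spaceI_bounded:
  assumes \<Omega>: "\<Omega> \<in> lmeasurable" and q: "q \<in> borel_measurable (lebesgue_on \<Omega>)"
    and B: "AE x in lebesgue. x \<in> \<Omega> \<longrightarrow> norm (q x) \<le> B"
  shows "q \<in> L2_space \<Omega>"
proof -
  interpret finite_measure "lebesgue_on \<Omega>" by (rule finite_measure_lebesgue_on[OF \<Omega>])
  have "AE x in lebesgue_on \<Omega>. norm (q x) \<le> B"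
    using B \<Omega> by (subst AE_restrict_space_iff) (auto simp: fmeasurable_def)
  then have "AE x in lebesgue_on \<Omega>. norm ((norm (q x))\<^sup>2) \<le> B\<^sup>2"
    by eventually_elim (simp add: power_mono)
  then have "integrable (lebesgue_on \<Omega>) (\<lambda>x. (norm (q x))\<^sup>2)"
    using q by (intro integrable_const_bound) auto
  then show ?thesis using q by (simp add: L2_space_def)
qed

section \<open>Linear structure of square integrable fields\<close>

lemma L2_space_add:
  assumes "f \<in> L2_space \<Omega>" "g \<in> L2_space \<Omega>"
  shows "(\<lambda>x. f x + g x) \<in> L2_space \<Omega>"
proof -
  have [measurable]: "f \<in> borel_measurable (lebesgue_on \<Omega>)" "g \<in> borel_measurable (lebesgue_on \<Omega>)"
    and i: "integrable (lebesgue_on \<Omega>) (\<lambda>x. 2 * (norm (f x))\<^sup>2 + 2 * (norm (g x))\<^sup>2)"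
    using assms by (auto simp: L2_space_def)
  have "(norm (f x + g x))\<^sup>2 \<le> 2 * (norm (f x))\<^sup>2 + 2 * (norm (g x))\<^sup>2" for x
  proof -
    have "(norm (f x + g x))\<^sup>2 \<le> (norm (f x) + norm (g x))\<^sup>2"
      by (intro power_mono norm_triangle_ineq) simp
    also have "\<dots> \<le> 2 * (norm (f x))\<^sup>2 + 2 * (norm (g x))\<^sup>2"
      using sum_squares_bound[of "norm (f x)" "norm (g x)"] by (simp add: power2_sum)
    finally show ?thesis .
  qed
  then have "integrable (lebesgue_on \<Omega>) (\<lambda>x. (norm (f x + g x))\<^sup>2)"
    by (intro Bochner_Integration.integrable_bound[OF i]) (auto intro!: AE_I2)
  then show ?thesis by (simp add: L2_space_def)
qed

lemma L2_space_scaleR: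
  assumes "f \<in> L2_space \<Omega>"
  shows "(\<lambda>x. c *\<^sub>R f x) \<in> L2_space \<Omega>"
  using assms by (auto simp: L2_space_def power_mult_distrib)

lemma L2_space_zero: "(\<lambda>x. 0) \<in> L2_space \<Omega>"
  by (simp add: L2_space_def)

lemma L2_space_component:
  fixes F :: "real^'n \<Rightarrow> real^'m"
  assumes "F \<in> L2_space \<Omega>"
  shows "(\<lambda>x. F x $ k) \<in> L2_space \<Omega>"
proof -
  have [measurable]: "F \<in> borel_measurable (lebesgue_on \<Omega>)"
    and i: "integrable (lebesgue_on \<Omega>) (\<lambda>x. (norm (F x))\<^sup>2)"
    using assms by (auto simp: L2_space_def)
  have m: "(\<lambda>x. F x $ k) \<in> borel_measurable (lebesgue_on \<Omega>)"
    by (simp add: cart_eq_inner_axis)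
  have "\<bar>F x $ k\<bar>\<^sup>2 \<le> (norm (F x))\<^sup>2" for x
    by (intro power_mono component_le_norm_cart) simp
  then have "integrable (lebesgue_on \<Omega>) (\<lambda>x. (norm (F x $ k))\<^sup>2)"
    using m by (intro Bochner_Integration.integrable_bound[OF i]) (auto intro!: AE_I2)
  then show ?thesis using m by (simp add: L2_space_def)
qed

lemma borel_measurable_vecI:
  fixes F :: "'a \<Rightarrow> real^'n"
  assumes "\<And>k. (\<lambda>x. F x $ k) \<in> borel_measurable N"
  shows "F \<in> borel_measurable N"
  by (rule borel_measurable_euclidean_space[THEN iffD2])
     (auto simp: Basis_vec_def inner_axis assms)

text \<open>Additivity of the pairings with test functions rests on this, since the Bochner integral
  of a non-integrable function is 0 by convention.\<close>

lemma L2_space_integrable_times: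
  fixes u \<psi> :: "real^'n \<Rightarrow> real"
  assumes \<Omega>: "\<Omega> \<in> lmeasurable" and u: "u \<in> L2_space \<Omega>"
    and \<psi>: "\<psi> \<in> borel_measurable borel" "\<And>x. \<bar>\<psi> x\<bar> \<le> B"
  shows "integrable (lebesgue_on \<Omega>) (\<lambda>x. u x * \<psi> x)"
proof -
  interpret finite_measure "lebesgue_on \<Omega>" by (rule finite_measure_lebesgue_on[OF \<Omega>])
  have um: "u \<in> borel_measurable (lebesgue_on \<Omega>)"
    and i: "integrable (lebesgue_on \<Omega>) (\<lambda>x. (norm (u x))\<^sup>2)"
    using u by (auto simp: L2_space_def)
  have "\<psi> \<in> borel_measurable lebesgue"
    using \<psi>(1) by (intro measurable_completion) simp
  then have \<psi>m: "\<psi> \<in> borel_measurable (lebesgue_on \<Omega>)"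
    by (rule measurable_restrict_space1)
  \<comment> \<open>The product is dominated by the sum of the squares; the constant
    \<open>B\<^sup>2\<close> is integrable because \<Omega> has finite measure.\<close>
  have b: "norm (u x * \<psi> x) \<le> norm ((norm (u x))\<^sup>2 + B\<^sup>2)" for x
  proof -
    have "\<bar>\<psi> x\<bar>\<^sup>2 \<le> B\<^sup>2" by (intro power_mono \<psi>) simp
    moreover have "2 * \<bar>u x\<bar> * \<bar>\<psi> x\<bar> \<le> \<bar>u x\<bar>\<^sup>2 + \<bar>\<psi> x\<bar>\<^sup>2" by (rule sum_squares_bound)
    moreover have "0 \<le> \<bar>u x\<bar> * \<bar>\<psi> x\<bar>" by simp
    ultimately have "\<bar>u x\<bar> * \<bar>\<psi> x\<bar> \<le> \<bar>u x\<bar>\<^sup>2 + B\<^sup>2" by linarith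
    then show ?thesis by (simp add: abs_mult)
  qed
  show ?thesis
  proof (rule Bochner_Integration.integrable_bound)
    show "integrable (lebesgue_on \<Omega>) (\<lambda>x. (norm (u x))\<^sup>2 + B\<^sup>2)"
      using i by (intro Bochner_Integration.integrable_add integrable_const)
    show "(\<lambda>x. u x * \<psi> x) \<in> borel_measurable (lebesgue_on \<Omega>)"
      by (rule borel_measurable_times[OF um \<psi>m])
  qed (intro AE_I2 b)
qed

definition weak_curl_space :: "(real^'n) set \<Rightarrow> (real^'n \<Rightarrow> real^'n) set" where
  "weak_curl_space \<Omega> = {F \<in> L2_space \<Omega>. \<forall>a b. \<exists>g\<in>L2_space \<Omega>. weak_curl \<Omega> a b F g}"

lemma weak_curl_add:
  assumes \<Omega>: "\<Omega> \<in> lmeasurable"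
    and L2: "F \<in> L2_space \<Omega>" "F' \<in> L2_space \<Omega>" "g \<in> L2_space \<Omega>" "g' \<in> L2_space \<Omega>"
    and "weak_curl \<Omega> a b F g" "weak_curl \<Omega> a b F' g'"
  shows "weak_curl \<Omega> a b (\<lambda>x. F x + F' x) (\<lambda>x. g x + g' x)"
  unfolding weak_curl_def
proof
  fix \<phi> assume \<phi>: "\<phi> \<in> test_functions \<Omega>"
  obtain B where B: "\<And>x. \<bar>\<phi> x\<bar> \<le> B" using test_function_bounded[OF \<phi>] by metis
  have ig: "integrable (lebesgue_on \<Omega>) (\<lambda>x. u x * \<phi> x)" if "u \<in> L2_space \<Omega>" for u :: "real^'a \<Rightarrow> real"
    by (rule L2_space_integrable_times[OF \<Omega> that test_functionD(5)[OF \<phi>] B])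
  have iF: "integrable (lebesgue_on \<Omega>) (\<lambda>x. H x $ j * partial k \<phi> x)" if H: "H \<in> L2_space \<Omega>"
    for H :: "real^'a \<Rightarrow> real^'a" and j k
  proof -
    obtain B where B: "\<And>x. \<bar>partial k \<phi> x\<bar> \<le> B" using test_function_partial_bounded[OF \<phi>] by metis
    show ?thesis
      by (rule L2_space_integrable_times[OF \<Omega> L2_space_component[OF H] test_functionD(6)[OF \<phi>] B])
  qed
  have dp: "dist_partial \<Omega> k (\<lambda>x. (F x + F' x) $ j) \<phi>
      = dist_partial \<Omega> k (\<lambda>x. F x $ j) \<phi> + dist_partial \<Omega> k (\<lambda>x. F' x $ j) \<phi>" for j k
    using iF[OF L2(1)] iF[OF L2(2)] by (simp add: dist_partial_def distrib_right)
  show "(\<integral>x. (g x + g' x) * \<phi> x \<partial>lebesgue_on \<Omega>)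
     = dist_partial \<Omega> b (\<lambda>x. (F x + F' x) $ a) \<phi> - dist_partial \<Omega> a (\<lambda>x. (F x + F' x) $ b) \<phi>"
    unfolding dp using assms(6,7) \<phi> ig[OF L2(3)] ig[OF L2(4)]
    by (simp add: distrib_right weak_curl_def)
qed

lemma weak_curl_scaleR:
  assumes "weak_curl \<Omega> a b F g"
  shows "weak_curl \<Omega> a b (\<lambda>x. c *\<^sub>R F x) (\<lambda>x. c *\<^sub>R g x)"
  using assms by (simp add: weak_curl_def dist_partial_def mult.assoc right_diff_distrib)

text \<open>Reduces membership of a span to membership of its generators.\<close>

lemma subspace_weak_curl_space:
  assumes \<Omega>: "\<Omega> \<in> lmeasurable"
  shows "subspace (weak_curl_space \<Omega>)"
proof (rule subspaceI)
  show "0 \<in> weak_curl_space \<Omega>"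
    by (auto simp: weak_curl_space_def zero_fun_def L2_space_zero weak_curl_def dist_partial_def
        intro!: bexI[of _ "\<lambda>_. 0"])
next
  fix F F' assume F: "F \<in> weak_curl_space \<Omega>" "F' \<in> weak_curl_space \<Omega>"
  have "\<exists>h\<in>L2_space \<Omega>. weak_curl \<Omega> a b (\<lambda>x. F x + F' x) h" for a b
  proof -
    obtain g g' where "g \<in> L2_space \<Omega>" "g' \<in> L2_space \<Omega>" "weak_curl \<Omega> a b F g" "weak_curl \<Omega> a b F' g'"
      using F unfolding weak_curl_space_def by blast
    then show ?thesis
      using F weak_curl_add[OF \<Omega>, of F F' g g' a b] L2_space_add[of g \<Omega> g']
      unfolding weak_curl_space_def by blast
  qed
  then show "F + F' \<in> weak_curl_space \<Omega>"
    using F by (simp add: weak_curl_space_def plus_fun_def L2_space_add)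
next
  fix c F assume F: "F \<in> weak_curl_space \<Omega>"
  have "\<exists>h\<in>L2_space \<Omega>. weak_curl \<Omega> a b (\<lambda>x. c *\<^sub>R F x) h" for a b
  proof -
    obtain g where "g \<in> L2_space \<Omega>" "weak_curl \<Omega> a b F g"
      using F unfolding weak_curl_space_def by blast
    then show ?thesis
      using weak_curl_scaleR[of \<Omega> a b F g c] L2_space_scaleR[of g \<Omega> c] by blast
  qed
  then show "c *\<^sub>R F \<in> weak_curl_space \<Omega>"
    using F by (simp add: weak_curl_space_def scaleR_fun_def L2_space_scaleR)
qed

lemma weakly_regular_gradient:
  fixes g :: "real^'n \<Rightarrow> real" and G :: "real^'n \<Rightarrow> real^'n"
  assumes g: "weakly_regular \<Omega> g" and \<Omega>: "open \<Omega>"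
    and G: "AE x in lebesgue. x \<in> \<Omega> \<longrightarrow> G x = (\<chi> k. partial k g x)"
  shows "G \<in> borel_measurable (lebesgue_on \<Omega>)" "\<exists>C\<ge>0. AE x in lebesgue. x \<in> \<Omega> \<longrightarrow> norm (G x) \<le> C"
proof -
  show "G \<in> borel_measurable (lebesgue_on \<Omega>)"
  proof (rule borel_measurable_vecI)
    fix k
    have "AE x in lebesgue. (if x \<in> \<Omega> then partial k g x else 0) = (if x \<in> \<Omega> then G x $ k else 0)"
      using G by eventually_elim simp
    then have "(\<lambda>x. if x \<in> \<Omega> then G x $ k else 0) \<in> borel_measurable lebesgue"
      by (rule borel_measurable_AE[OF weakly_regular_partial_measurable[OF g \<Omega>]])
    then show "(\<lambda>x. G x $ k) \<in> borel_measurable (lebesgue_on \<Omega>)"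
      by (rule borel_measurable_if_D)
  qed
  have "\<forall>k. \<exists>C. AE x in lebesgue. x \<in> \<Omega> \<longrightarrow> \<bar>partial k g x\<bar> \<le> C"
    using weakly_regular_partial_bound[OF g \<Omega>] by metis
  then obtain C where C: "\<And>k. AE x in lebesgue. x \<in> \<Omega> \<longrightarrow> \<bar>partial k g x\<bar> \<le> C k"
    by metis
  have "AE x in lebesgue. \<forall>k\<in>UNIV. x \<in> \<Omega> \<longrightarrow> \<bar>partial k g x\<bar> \<le> C k"
    by (rule AE_finite_allI) (auto simp: C)
  with G have "AE x in lebesgue. x \<in> \<Omega> \<longrightarrow> norm (G x) \<le> \<bar>sum C UNIV\<bar>"
  proof eventually_elim
    case (elim x)
    show ?case
    proof
      assume "x \<in> \<Omega>"
      then have "norm (G x) \<le> (\<Sum>k\<in>UNIV. \<bar>partial k g x\<bar>)"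
        using norm_le_l1_cart[of "G x"] elim by simp
      also have "\<dots> \<le> sum C UNIV"
        using elim \<open>x \<in> \<Omega>\<close> by (intro sum_mono) simp
      finally show "norm (G x) \<le> \<bar>sum C UNIV\<bar>" by simp
    qed
  qed
  then show "\<exists>C\<ge>0. AE x in lebesgue. x \<in> \<Omega> \<longrightarrow> norm (G x) \<le> C"
    using abs_ge_zero by blast
qed

text \<open>The field and its weak curl are products of functions bounded almost everywhere, and on
  a domain of finite measure such functions are square integrable.\<close>

lemma scaled_gradient_in_weak_curl_space:
  fixes f g :: "real^'n \<Rightarrow> real" and G H :: "real^'n \<Rightarrow> real^'n"
  assumes f: "weakly_regular \<Omega> f" and g: "weakly_regular \<Omega> g" and \<Omega>: "open \<Omega>" "\<Omega> \<in> lmeasurable"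
    and G: "AE x in lebesgue. x \<in> \<Omega> \<longrightarrow> G x = (\<chi> k. partial k g x)"
    and H: "AE x in lebesgue. x \<in> \<Omega> \<longrightarrow> H x = (\<chi> k. partial k f x)"
  shows "(\<lambda>x. f x *\<^sub>R G x) \<in> weak_curl_space \<Omega>"
proof -
  note Gm = weakly_regular_gradient(1)[OF g \<Omega>(1) G]
    and Hm = weakly_regular_gradient(1)[OF f \<Omega>(1) H]
  obtain C where C: "0 \<le> C" "AE x in lebesgue. x \<in> \<Omega> \<longrightarrow> norm (G x) \<le> C"
    using weakly_regular_gradient(2)[OF g \<Omega>(1) G] by metis
  obtain D where D: "0 \<le> D" "AE x in lebesgue. x \<in> \<Omega> \<longrightarrow> norm (H x) \<le> D"
    using weakly_regular_gradient(2)[OF f \<Omega>(1) H] by metis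
  obtain B where B: "\<And>x. \<bar>f x\<bar> \<le> B"
    using f unfolding weakly_regular_def by blast
  have B0: "0 \<le> B" using B[of 0] by simp
  have "f \<in> borel_measurable lebesgue"
    using f by (intro measurable_completion) (simp add: weakly_regular_def)
  then have fm: "f \<in> borel_measurable (lebesgue_on \<Omega>)"
    by (rule measurable_restrict_space1)
  have "(\<lambda>x. f x *\<^sub>R G x) \<in> L2_space \<Omega>"
  proof (rule L2_spaceI_bounded[OF \<Omega>(2)])
    show "(\<lambda>x. f x *\<^sub>R G x) \<in> borel_measurable (lebesgue_on \<Omega>)"
      by (rule borel_measurable_scaleR[OF fm Gm])
    show "AE x in lebesgue. x \<in> \<Omega> \<longrightarrow> norm (f x *\<^sub>R G x) \<le> B * C"
      using C(2) by eventually_elim (simp add: mult_mono B B0)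
  qed
  moreover have "\<exists>c\<in>L2_space \<Omega>. weak_curl \<Omega> a b (\<lambda>x. f x *\<^sub>R G x) c" for a b
  proof
    show "weak_curl \<Omega> a b (\<lambda>x. f x *\<^sub>R G x) (\<lambda>x. G x $ a * H x $ b - G x $ b * H x $ a)"
      by (rule weak_curl_scaled_gradient[OF f g \<Omega>(1) G H])
    show "(\<lambda>x. G x $ a * H x $ b - G x $ b * H x $ a) \<in> L2_space \<Omega>"
    proof (rule L2_spaceI_bounded[OF \<Omega>(2)])
      have comp: "(\<lambda>x. K x $ k) \<in> borel_measurable (lebesgue_on \<Omega>)"
        if "K \<in> borel_measurable (lebesgue_on \<Omega>)" for K :: "real^'n \<Rightarrow> real^'n" and k
        using that by (simp add: cart_eq_inner_axis)
      show "(\<lambda>x. G x $ a * H x $ b - G x $ b * H x $ a) \<in> borel_measurable (lebesgue_on \<Omega>)"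
        by (intro borel_measurable_diff borel_measurable_times comp[OF Gm] comp[OF Hm])
      show "AE x in lebesgue. x \<in> \<Omega> \<longrightarrow> norm (G x $ a * H x $ b - G x $ b * H x $ a) \<le> C * D + C * D"
        using C(2) D(2)
      proof eventually_elim
        case (elim x)
        show ?case
        proof
          assume "x \<in> \<Omega>"
          have "\<bar>G x $ i * H x $ j\<bar> \<le> C * D" for i j
            unfolding abs_mult
            using elim \<open>x \<in> \<Omega>\<close> C(1)
            by (intro mult_mono order_trans[OF component_le_norm_cart]) auto
          then show "norm (G x $ a * H x $ b - G x $ b * H x $ a) \<le> C * D + C * D"
            unfolding real_norm_def by (intro order_trans[OF abs_triangle_ineq4] add_mono)
        qed
      qed
    qed
  qed
  ultimately show ?thesis by (simp add: weak_curl_space_def)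
qed

lemma span_hat_subset_weak_curl_space:
  fixes M :: "(real^'n) set set"
  assumes "CARD('n) \<le> 3" "polytopal_mesh M" "mesh_coords M \<Lambda>"
    and S: "\<And>F. F \<in> S \<Longrightarrow> \<exists>w w'. F = (\<lambda>x. hat M \<Lambda> w x *\<^sub>R cellwise_grad M (hat M \<Lambda> w') x)"
  shows "span S \<subseteq> weak_curl_space (mesh_domain M)"
proof (rule span_minimal[OF _ subspace_weak_curl_space[OF mesh_domain_lmeasurable[OF assms(2)]]])
  show "S \<subseteq> weak_curl_space (mesh_domain M)"
  proof
    fix F assume "F \<in> S"
    then obtain w w' where F: "F = (\<lambda>x. hat M \<Lambda> w x *\<^sub>R cellwise_grad M (hat M \<Lambda> w') x)"
      using S by metis
    show "F \<in> weak_curl_space (mesh_domain M)"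
      unfolding F
      by (rule scaled_gradient_in_weak_curl_space[OF hat_weakly_regular[OF assms(1-3)]
            hat_weakly_regular[OF assms(1-3)] open_mesh_domain mesh_domain_lmeasurable[OF assms(2)]
            AE_cellwise_grad[OF assms(2)] AE_cellwise_grad[OF assms(2)]])
  qed
qed

section \<open>Specialization to the plane and to space\<close>

lemma weak_curl_space_subset_Hcurl2: "weak_curl_space (mesh_domain M) \<subseteq> Hcurl2 M"
proof
  fix F assume F: "F \<in> weak_curl_space (mesh_domain M)"
  then obtain g where "g \<in> L2_space (mesh_domain M)" "weak_curl (mesh_domain M) 1 2 F g"
    unfolding weak_curl_space_def by blast
  then show "F \<in> Hcurl2 M"
    using F by (auto simp: Hcurl2_def weak_curl_space_def is_curl2_def weak_curl_def)
qed

lemma L2_space_vector_3: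
  fixes g1 g2 g3 :: "real^'n \<Rightarrow> real"
  assumes "g1 \<in> L2_space \<Omega>" "g2 \<in> L2_space \<Omega>" "g3 \<in> L2_space \<Omega>"
  shows "(\<lambda>x. vector [g1 x, g2 x, g3 x] :: real^3) \<in> L2_space \<Omega>"
proof -
  have m: "(\<lambda>x. vector [g1 x, g2 x, g3 x] :: real^3) \<in> borel_measurable (lebesgue_on \<Omega>)"
  proof (rule borel_measurable_vecI)
    show "(\<lambda>x. (vector [g1 x, g2 x, g3 x] :: real^3) $ k) \<in> borel_measurable (lebesgue_on \<Omega>)" for k
      using exhaust_3[of k] assms by (auto simp: L2_space_def)
  qed
  have "integrable (lebesgue_on \<Omega>) (\<lambda>x. (norm (vector [g1 x, g2 x, g3 x] :: real^3))\<^sup>2)"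
    using assms unfolding power2_norm_eq_inner inner_vec_def sum_3
    by (simp add: L2_space_def power2_eq_square)
  with m show ?thesis by (simp add: L2_space_def)
qed

lemma weak_curl_space_subset_Hcurl3: "weak_curl_space (mesh_domain M) \<subseteq> Hcurl3 M"
proof
  fix F assume F: "F \<in> weak_curl_space (mesh_domain M)"
  then have *: "\<exists>g\<in>L2_space (mesh_domain M). weak_curl (mesh_domain M) a b F g" for a b
    unfolding weak_curl_space_def by blast
  \<comment> \<open>The second index of \<open>weak_curl\<close> is the direction of the derivative
    with positive sign, so the component
    \<open>\<partial>\<^sub>2 F\<^sub>3 - \<partial>\<^sub>3 F\<^sub>2\<close> belongs to the pair
    (3, 2); the other two follow cyclically.\<close>
  obtain g1 where g1: "g1 \<in> L2_space (mesh_domain M)" "weak_curl (mesh_domain M) 3 2 F g1"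
    using *[of 3 2] by blast
  obtain g2 where g2: "g2 \<in> L2_space (mesh_domain M)" "weak_curl (mesh_domain M) 1 3 F g2"
    using *[of 1 3] by blast
  obtain g3 where g3: "g3 \<in> L2_space (mesh_domain M)" "weak_curl (mesh_domain M) 2 1 F g3"
    using *[of 2 1] by blast
  have "is_curl3 (mesh_domain M) F (\<lambda>x. vector [g1 x, g2 x, g3 x])"
    using g1 g2 g3 by (simp add: is_curl3_def weak_curl_def)
  with L2_space_vector_3[OF g1(1) g2(1) g3(1)] show "F \<in> Hcurl3 M"
    using F by (auto simp: Hcurl3_def weak_curl_space_def)
qed

theorem theorem3p3:
  shows "(\<forall>(M :: (real^2) set set) (p :: nat) (v :: nat \<Rightarrow> real^2)
            (\<Lambda> :: (real^2) set \<Rightarrow> real^2 \<Rightarrow> real^2 \<Rightarrow> real) (u :: real^2 \<Rightarrow> real^2).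
           polytopal_mesh M \<and> bij_betw v {1..p} (mesh_vertices M) \<and> mesh_coords M \<Lambda> \<and>
           u \<in> span {(\<lambda>x. hat M \<Lambda> (v i) x *\<^sub>R cellwise_grad M (hat M \<Lambda> (v j)) x) | i j.
                       i \<in> {1..p} \<and> j \<in> {1..p} \<and>
                       (\<exists>m\<in>M. v i \<in> vertices m \<and> v j \<in> vertices m)}
           \<longrightarrow> u \<in> Hcurl2 M)
       \<and> (\<forall>(M :: (real^3) set set) (p :: nat) (v :: nat \<Rightarrow> real^3)
            (\<Lambda> :: (real^3) set \<Rightarrow> real^3 \<Rightarrow> real^3 \<Rightarrow> real) (u :: real^3 \<Rightarrow> real^3).
           polytopal_mesh M \<and> bij_betw v {1..p} (mesh_vertices M) \<and> mesh_coords M \<Lambda> \<and>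
           u \<in> span {(\<lambda>x. hat M \<Lambda> (v i) x *\<^sub>R cellwise_grad M (hat M \<Lambda> (v j)) x) | i j.
                       i \<in> {1..p} \<and> j \<in> {1..p} \<and>
                       (\<exists>m\<in>M. v i \<in> vertices m \<and> v j \<in> vertices m)}
           \<longrightarrow> u \<in> Hcurl3 M)"
proof (intro conjI allI impI)
  fix M :: "(real^2) set set" and p and v :: "nat \<Rightarrow> real^2" and \<Lambda> and u
  let ?S = "{(\<lambda>x. hat M \<Lambda> (v i) x *\<^sub>R cellwise_grad M (hat M \<Lambda> (v j)) x) | i j.
               i \<in> {1..p} \<and> j \<in> {1..p} \<and> (\<exists>m\<in>M. v i \<in> vertices m \<and> v j \<in> vertices m)}"
  assume A: "polytopal_mesh M \<and> bij_betw v {1..p} (mesh_vertices M) \<and> mesh_coords M \<Lambda> \<and> u \<in> span ?S"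
  have "span ?S \<subseteq> weak_curl_space (mesh_domain M)"
    by (rule span_hat_subset_weak_curl_space[of M \<Lambda>]) (use A in auto)
  then show "u \<in> Hcurl2 M" using A weak_curl_space_subset_Hcurl2 by blast
next
  fix M :: "(real^3) set set" and p and v :: "nat \<Rightarrow> real^3" and \<Lambda> and u
  let ?S = "{(\<lambda>x. hat M \<Lambda> (v i) x *\<^sub>R cellwise_grad M (hat M \<Lambda> (v j)) x) | i j.
               i \<in> {1..p} \<and> j \<in> {1..p} \<and> (\<exists>m\<in>M. v i \<in> vertices m \<and> v j \<in> vertices m)}"
  assume A: "polytopal_mesh M \<and> bij_betw v {1..p} (mesh_vertices M) \<and> mesh_coords M \<Lambda> \<and> u \<in> span ?S"
  have "span ?S \<subseteq> weak_curl_space (mesh_domain M)"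
    by (rule span_hat_subset_weak_curl_space[of M \<Lambda>]) (use A in auto)
  then show "u \<in> Hcurl3 M" using A weak_curl_space_subset_Hcurl3 by blast
qed

end
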